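(* Let $s \ge 3$ and $k \ge s+2$ be integers. Then there exists $\alpha > 0$ such that $$\frac{1}{\alpha} > \binom{k-1}{s-1} - 1 - \frac{s-1}{k-1} - \frac{2}{\binom{k-1}{s-1}}$$ and the random hypergraph $G^s(n, n^{-\alpha})$ does not obey the zero-one $k$-law.
   Context: For integers $s \ge 2$, $n \ge 1$ and $p\in[0,1]$, the random $s$-uniform hypergraph $G^s(n,p)$ is the random $s$-uniform hypergraph on vertex set $\{1,\dots,n\}$ in which each of the $\binom{n}{s}$ possible $s$-element edges is present independently with probability $p$. First-order properties of $s$-uniform hypergraphs are those expressible by first-order formulae built from the $s$-ary predicate symbol $N$ (meaning "these $s$ vertices form an edge"), equality, logical connectives, variables and quantifiers $\forall,\exists$ over vertices. The quantifier depth of a formula is the maximum number of nested quantifiers. $G^s(n,p(n))$ obeys the zero-one $k$-law if for every first-order property $L$ expressible by a formula of quantifier depth at most $k$, the probability $\Pr[G^s(n,p(n)) \models L]$ tends either to $0$ or to $1$ as $n\to\infty$. *)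

theory Defs
  imports "HOL-Probability.Probability"
begin

text \<open>First-order formulae over equality and one relation symbol \<open>N\<close>, with variables named by
  natural numbers. The arity of \<open>N\<close> is enforced by \<open>fo_wf\<close>.\<close>

datatype fo =
    Eq nat nat
  | N "nat list"
  | Neg fo
  | Conj fo fo
  | Disj fo fo
  | Imp fo fo
  | Iff fo fo
  | All nat fo
  | Ex nat fo

primrec fo_wf :: "nat \<Rightarrow> fo \<Rightarrow> bool" where
  "fo_wf s (Eq x y) = True"
| "fo_wf s (N xs) = (length xs = s)"
| "fo_wf s (Neg \<phi>) = fo_wf s \<phi>"
| "fo_wf s (Conj \<phi> \<psi>) = (fo_wf s \<phi> \<and> fo_wf s \<psi>)"
| "fo_wf s (Disj \<phi> \<psi>) = (fo_wf s \<phi> \<and> fo_wf s \<psi>)"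
| "fo_wf s (Imp \<phi> \<psi>) = (fo_wf s \<phi> \<and> fo_wf s \<psi>)"
| "fo_wf s (Iff \<phi> \<psi>) = (fo_wf s \<phi> \<and> fo_wf s \<psi>)"
| "fo_wf s (All x \<phi>) = fo_wf s \<phi>"
| "fo_wf s (Ex x \<phi>) = fo_wf s \<phi>"

primrec free_vars :: "fo \<Rightarrow> nat set" where
  "free_vars (Eq x y) = {x, y}"
| "free_vars (N xs) = set xs"
| "free_vars (Neg \<phi>) = free_vars \<phi>"
| "free_vars (Conj \<phi> \<psi>) = free_vars \<phi> \<union> free_vars \<psi>"
| "free_vars (Disj \<phi> \<psi>) = free_vars \<phi> \<union> free_vars \<psi>"
| "free_vars (Imp \<phi> \<psi>) = free_vars \<phi> \<union> free_vars \<psi>"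
| "free_vars (Iff \<phi> \<psi>) = free_vars \<phi> \<union> free_vars \<psi>"
| "free_vars (All x \<phi>) = free_vars \<phi> - {x}"
| "free_vars (Ex x \<phi>) = free_vars \<phi> - {x}"

definition sentence :: "nat \<Rightarrow> fo \<Rightarrow> bool" where
  "sentence s \<phi> \<longleftrightarrow> fo_wf s \<phi> \<and> free_vars \<phi> = {}"

primrec quantifier_depth :: "fo \<Rightarrow> nat" where
  "quantifier_depth (Eq x y) = 0"
| "quantifier_depth (N xs) = 0"
| "quantifier_depth (Neg \<phi>) = quantifier_depth \<phi>"
| "quantifier_depth (Conj \<phi> \<psi>) = max (quantifier_depth \<phi>) (quantifier_depth \<psi>)"
| "quantifier_depth (Disj \<phi> \<psi>) = max (quantifier_depth \<phi>) (quantifier_depth \<psi>)"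
| "quantifier_depth (Imp \<phi> \<psi>) = max (quantifier_depth \<phi>) (quantifier_depth \<psi>)"
| "quantifier_depth (Iff \<phi> \<psi>) = max (quantifier_depth \<phi>) (quantifier_depth \<psi>)"
| "quantifier_depth (All x \<phi>) = Suc (quantifier_depth \<phi>)"
| "quantifier_depth (Ex x \<phi>) = Suc (quantifier_depth \<phi>)"

text \<open>In an \<open>s\<close>-uniform hypergraph, \<open>N\<close> is false on \<open>s\<close>-tuples with a repeated vertex: the set of
  their entries has fewer than \<open>s\<close> elements, so it is not an edge.\<close>

primrec fo_sat :: "'v set \<Rightarrow> 'v set set \<Rightarrow> (nat \<Rightarrow> 'v) \<Rightarrow> fo \<Rightarrow> bool" where
  "fo_sat V E v (Eq x y) \<longleftrightarrow> v x = v y"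
| "fo_sat V E v (N xs) \<longleftrightarrow> v ` set xs \<in> E"
| "fo_sat V E v (Neg \<phi>) \<longleftrightarrow> \<not> fo_sat V E v \<phi>"
| "fo_sat V E v (Conj \<phi> \<psi>) \<longleftrightarrow> fo_sat V E v \<phi> \<and> fo_sat V E v \<psi>"
| "fo_sat V E v (Disj \<phi> \<psi>) \<longleftrightarrow> fo_sat V E v \<phi> \<or> fo_sat V E v \<psi>"
| "fo_sat V E v (Imp \<phi> \<psi>) \<longleftrightarrow> (fo_sat V E v \<phi> \<longrightarrow> fo_sat V E v \<psi>)"
| "fo_sat V E v (Iff \<phi> \<psi>) \<longleftrightarrow> (fo_sat V E v \<phi> \<longleftrightarrow> fo_sat V E v \<psi>)"
| "fo_sat V E v (All x \<phi>) \<longleftrightarrow> (\<forall>a\<in>V. fo_sat V E (v(x := a)) \<phi>)"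
| "fo_sat V E v (Ex x \<phi>) \<longleftrightarrow> (\<exists>a\<in>V. fo_sat V E (v(x := a)) \<phi>)"

lemma fo_sat_cong:
  "(\<And>x. x \<in> free_vars \<phi> \<Longrightarrow> v x = w x) \<Longrightarrow> fo_sat V E v \<phi> \<longleftrightarrow> fo_sat V E w \<phi>"
proof (induction \<phi> arbitrary: v w)
  case (Eq x y)
  then show ?case by simp
next
  case (N xs)
  then have "v ` set xs = w ` set xs" by (intro image_cong) auto
  then show ?case by simp
next
  case (Neg \<phi>)
  have "fo_sat V E v \<phi> = fo_sat V E w \<phi>"
    by (rule Neg.IH) (simp add: Neg.prems)
  then show ?case by simp
next
  case (Conj \<phi> \<psi>)
  have "fo_sat V E v \<phi> = fo_sat V E w \<phi>" "fo_sat V E v \<psi> = fo_sat V E w \<psi>"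
    by (rule Conj.IH, simp add: Conj.prems)+
  then show ?case by simp
next
  case (Disj \<phi> \<psi>)
  have "fo_sat V E v \<phi> = fo_sat V E w \<phi>" "fo_sat V E v \<psi> = fo_sat V E w \<psi>"
    by (rule Disj.IH, simp add: Disj.prems)+
  then show ?case by simp
next
  case (Imp \<phi> \<psi>)
  have "fo_sat V E v \<phi> = fo_sat V E w \<phi>" "fo_sat V E v \<psi> = fo_sat V E w \<psi>"
    by (rule Imp.IH, simp add: Imp.prems)+
  then show ?case by simp
next
  case (Iff \<phi> \<psi>)
  have "fo_sat V E v \<phi> = fo_sat V E w \<phi>" "fo_sat V E v \<psi> = fo_sat V E w \<psi>"
    by (rule Iff.IH, simp add: Iff.prems)+
  then show ?case by simp
next
  case (All x \<phi>)
  have "fo_sat V E (v(x := a)) \<phi> = fo_sat V E (w(x := a)) \<phi>" for a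
    by (rule All.IH) (simp add: All.prems)
  then show ?case by simp
next
  case (Ex x \<phi>)
  have "fo_sat V E (v(x := a)) \<phi> = fo_sat V E (w(x := a)) \<phi>" for a
    by (rule Ex.IH) (simp add: Ex.prems)
  then show ?case by simp
qed

text \<open>The valuation is irrelevant for sentences, the only formulae to which \<open>models\<close> is applied.\<close>

definition models :: "'v set \<Rightarrow> 'v set set \<Rightarrow> fo \<Rightarrow> bool" where
  "models V E \<phi> \<longleftrightarrow> (\<forall>v. fo_sat V E v \<phi>)"

lemma models_sentence_iff: "sentence s \<phi> \<Longrightarrow> models V E \<phi> \<longleftrightarrow> fo_sat V E v \<phi>"
  unfolding models_def sentence_def using fo_sat_cong[of \<phi> _ v V E] by auto

definition possible_edges :: "nat \<Rightarrow> nat \<Rightarrow> nat set set" where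
  "possible_edges s n = {e. e \<subseteq> {1..n} \<and> card e = s}"

text \<open>The distribution of the edge set of \<open>G\<^sup>s(n, p)\<close>.\<close>

definition random_hypergraph :: "nat \<Rightarrow> nat \<Rightarrow> real \<Rightarrow> nat set set pmf" where
  "random_hypergraph s n p =
     map_pmf (\<lambda>present. {e \<in> possible_edges s n. present e})
       (Pi_pmf (possible_edges s n) False (\<lambda>_. bernoulli_pmf p))"

definition obeys_zero_one_law :: "nat \<Rightarrow> nat \<Rightarrow> (nat \<Rightarrow> real) \<Rightarrow> bool" where
  "obeys_zero_one_law s k p \<longleftrightarrow>
     (\<forall>\<phi>. sentence s \<phi> \<and> quantifier_depth \<phi> \<le> k \<longrightarrow>
        (let P = \<lambda>n. measure_pmf.prob (random_hypergraph s n (p n)) {E. models {1..n} E \<phi>}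
         in P \<longlonglongrightarrow> 0 \<or> P \<longlonglongrightarrow> 1))"

end

theory Submission
  imports Defs
begin

text \<open>
  Put \<open>r = k - 2\<close>. The sentence asks for distinct vertices \<open>x\<^sub>0, \<dots>, x\<^bsub>r-1\<^esub>\<close> such that, for every
  two-element set \<open>i\<close> of \<open>(s - 1)\<close>-subsets of \<open>{0, \<dots>, r}\<close>, there is a vertex \<open>y\<close> joined to
  every \<open>(s - 1)\<close>-subset of the \<open>x\<close>'s and for which the following holds: a vertex \<open>z\<close> whose link
  over \<open>x\<^sub>0, \<dots>, x\<^bsub>r-1\<^esub>, y\<close> is complete except for exactly the \<open>(s - 1)\<close>-subset \<open>t\<close> exists if and only
  if \<open>t \<notin> i\<close>. Different \<open>i\<close> force different \<open>y\<close>, although only two quantifiers follow the \<open>x\<close>'s, so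
  the sentence of depth \<open>k\<close> forces a large structure. With \<open>m = (k-1 choose s-1)\<close> its
  minimal model has \<open>(m choose 2)\<close> vertices \<open>y\<close>, each with \<open>m - 2\<close> vertices \<open>z\<close> bringing \<open>m - 1\<close>
  edges each, and its density \<open>\<rho>\<close> (edges per vertex) is just below \<open>m - 1\<close>.

  Take \<open>\<alpha> = 1/\<rho>\<close>. Identifying vertices of the minimal model keeps the density at least \<open>\<rho>\<close>, so the
  sentence implies a bounded vertex set of density at least \<open>\<rho>\<close>; by Harris' inequality there is no
  such set with probability bounded away from \<open>0\<close>. Conversely the minimal model is balanced, so by
  the second moment method it occurs with probability bounded away from \<open>0\<close>, and since any
  additional edge or link over it would produce a set of density greater than \<open>\<rho>\<close>, which asymptotically
  almost surely does not exist, its copy satisfies the sentence.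
\<close>

section \<open>Expectations over random subsets\<close>

text \<open>The expectation of \<open>f\<close> over a random subset of \<open>A\<close> that
  contains each element independently with probability \<open>p\<close>. As a finite sum it admits
  induction on \<open>A\<close>.\<close>

definition bexp :: "'a set \<Rightarrow> real \<Rightarrow> ('a set \<Rightarrow> real) \<Rightarrow> real" where
  "bexp A p f = (\<Sum>F\<in>Pow A. p ^ card F * (1 - p) ^ card (A - F) * f F)"

lemma bexp_empty [simp]: "bexp {} p f = f {}"
  by (simp add: bexp_def)

text \<open>Conditioning on whether \<open>a\<close> belongs to the random subset.\<close>

lemma bexp_insert:
  assumes "finite A" "a \<notin> A"
  shows "bexp (insert a A) p f = (1 - p) * bexp A p f + p * bexp A p (\<lambda>F. f (insert a F))"
proof -
  let ?w = "\<lambda>A F. p ^ card F * (1 - p) ^ card (A - F)"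
  have inj: "inj_on (insert a) (Pow A)"
    using assms by (auto simp: inj_on_def)
  have disj: "Pow A \<inter> insert a ` Pow A = {}"
    using assms by auto
  have 1: "?w (insert a A) F = (1 - p) * ?w A F" if "F \<in> Pow A" for F
  proof -
    have "insert a A - F = insert a (A - F)" "a \<notin> A - F" "finite (A - F)"
      using that assms by auto
    then show ?thesis by simp
  qed
  have 2: "?w (insert a A) (insert a F) = p * ?w A F" if "F \<in> Pow A" for F
  proof -
    have "insert a A - insert a F = A - F" "a \<notin> F" "finite F"
      using that assms by (auto intro: finite_subset)
    then show ?thesis by simp
  qed
  have "bexp (insert a A) p f = (\<Sum>F\<in>Pow A. ?w (insert a A) F * f F)
      + (\<Sum>F\<in>Pow A. ?w (insert a A) (insert a F) * f (insert a F))"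
    unfolding bexp_def Pow_insert using assms disj inj
    by (subst sum.union_disjoint) (auto simp: sum.reindex)
  also have "\<dots> = (\<Sum>F\<in>Pow A. (1 - p) * (?w A F * f F))
      + (\<Sum>F\<in>Pow A. p * (?w A F * f (insert a F)))"
    by (intro arg_cong2[where f = "(+)"] sum.cong refl) (simp_all only: 1 2 mult.assoc)
  finally show ?thesis by (simp add: bexp_def sum_distrib_left)
qed

lemma bexp_mono:
  assumes "0 \<le> p" "p \<le> 1" "\<And>F. F \<subseteq> A \<Longrightarrow> f F \<le> g F"
  shows "bexp A p f \<le> bexp A p g"
  unfolding bexp_def using assms by (intro sum_mono mult_left_mono) auto

lemma bexp_cong: "(\<And>F. F \<subseteq> A \<Longrightarrow> f F = g F) \<Longrightarrow> bexp A p f = bexp A p g"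
  by (simp add: bexp_def)

lemma bexp_diff: "bexp A p (\<lambda>F. f F - g F) = bexp A p f - bexp A p g"
  by (simp add: bexp_def algebra_simps sum_subtractf)

lemma bexp_cmult: "bexp A p (\<lambda>F. c * f F) = c * bexp A p f"
  by (simp add: bexp_def sum_distrib_left mult_ac)

lemma bexp_sum: "bexp A p (\<lambda>F. \<Sum>i\<in>I. f i F) = (\<Sum>i\<in>I. bexp A p (f i))"
  unfolding bexp_def sum_distrib_left by (rule sum.swap)

lemma bexp_superset:
  assumes "finite A" "D \<subseteq> A"
  shows "bexp A p (\<lambda>F. of_bool (D \<subseteq> F)) = p ^ card D"
  using assms
proof (induction A arbitrary: D rule: finite_induct)
  case (insert a A)
  show ?case
  proof (cases "a \<in> D")
    case True
    have "bexp A p (\<lambda>F. of_bool (D \<subseteq> F)) = bexp A p (\<lambda>F. 0)"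
      using insert.hyps True by (intro bexp_cong) auto
    moreover have "bexp A p (\<lambda>F. of_bool (D \<subseteq> insert a F)) = bexp A p (\<lambda>F. of_bool (D - {a} \<subseteq> F))"
      by (intro bexp_cong) (auto simp: subset_insert_iff True)
    moreover have "D - {a} \<subseteq> A" using insert.prems by auto
    moreover have "finite D" using insert.prems insert.hyps by (auto intro: finite_subset)
    then have "p ^ card D = p * p ^ card (D - {a})"
      using True by (metis card.remove power_Suc)
    ultimately show ?thesis using insert by (simp add: bexp_insert bexp_def[of A p "\<lambda>F. 0"])
  next
    case False
    then have "D \<subseteq> A" using insert.prems by auto
    moreover have "bexp A p (\<lambda>F. of_bool (D \<subseteq> insert a F)) = bexp A p (\<lambda>F. of_bool (D \<subseteq> F))"
      using False by (intro bexp_cong) (auto simp: subset_insert)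
    ultimately show ?thesis using insert by (simp add: bexp_insert algebra_simps)
  qed
qed simp

lemma bexp_const: "finite A \<Longrightarrow> bexp A p (\<lambda>F. c) = c"
  using bexp_superset[of A "{}" p] bexp_cmult[of A p c "\<lambda>_. 1"] by simp

text \<open>Harris' inequality for two decreasing functions. After conditioning on the new element
  \<open>a\<close>, the induction hypothesis handles each case, and Chebyshev's inequality on a
  two-point space combines them.\<close>

lemma bexp_harris:
  assumes "finite A" "0 \<le> p" "p \<le> 1"
    and "\<And>F G. F \<subseteq> G \<Longrightarrow> G \<subseteq> A \<Longrightarrow> f G \<le> f F" "\<And>F G. F \<subseteq> G \<Longrightarrow> G \<subseteq> A \<Longrightarrow> g G \<le> g F"
  shows "bexp A p f * bexp A p g \<le> bexp A p (\<lambda>F. f F * g F)"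
  using assms(1,4,5)
proof (induction A arbitrary: f g rule: finite_induct)
  case (insert a A)
  define f1 g1 where "f1 = (\<lambda>F. f (insert a F))" and "g1 = (\<lambda>F. g (insert a F))"
  have dec: "f G \<le> f F" "g G \<le> g F" "f1 G \<le> f1 F" "g1 G \<le> g1 F" if "F \<subseteq> G" "G \<subseteq> A" for F G
    using insert.prems[of F G] insert.prems[of "insert a F" "insert a G"] that
    by (auto simp: f1_def g1_def)
  have le: "bexp A p f1 \<le> bexp A p f" "bexp A p g1 \<le> bexp A p g"
    using assms(2,3)
    by (auto intro!: bexp_mono insert.prems simp: f1_def g1_def)
  have "bexp A p f * bexp A p g \<le> bexp A p (\<lambda>F. f F * g F)"
    by (rule insert.IH) (use dec in auto)
  moreover have "bexp A p f1 * bexp A p g1 \<le> bexp A p (\<lambda>F. f1 F * g1 F)"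
    by (rule insert.IH) (use dec in auto)
  ultimately have IH: "(1 - p) * (bexp A p f * bexp A p g) + p * (bexp A p f1 * bexp A p g1)
      \<le> (1 - p) * bexp A p (\<lambda>F. f F * g F) + p * bexp A p (\<lambda>F. f1 F * g1 F)"
    using assms(2,3) by (intro add_mono mult_left_mono) auto
  \<comment> \<open>This is the mean of the two products minus the product of the two means; both
    differences are nonnegative because adding \<open>a\<close> decreases \<open>f\<close> and
    \<open>g\<close>.\<close>
  have "0 \<le> p * (1 - p) * ((bexp A p f - bexp A p f1) * (bexp A p g - bexp A p g1))"
    using assms(2,3) le by (intro mult_nonneg_nonneg) auto
  then have "((1 - p) * bexp A p f + p * bexp A p f1) * ((1 - p) * bexp A p g + p * bexp A p g1)
      \<le> (1 - p) * (bexp A p f * bexp A p g) + p * (bexp A p f1 * bexp A p g1)"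
    by (simp add: algebra_simps)
  with IH show ?case using insert.hyps by (simp add: bexp_insert f1_def g1_def)
qed simp

text \<open>Not containing \<open>D i\<close> is a decreasing event, so by Harris' inequality all
  these events occur together with at least the probability that independence would give.\<close>

lemma bexp_avoid_ge_prod:
  assumes "finite A" "0 \<le> p" "p \<le> 1" "finite I" "\<And>i. i \<in> I \<Longrightarrow> D i \<subseteq> A"
  shows "(\<Prod>i\<in>I. 1 - p ^ card (D i)) \<le> bexp A p (\<lambda>F. of_bool (\<forall>i\<in>I. \<not> D i \<subseteq> F))"
  using assms(4,5)
proof (induction I rule: finite_induct)
  case empty
  then show ?case using assms by (simp add: bexp_const)
next
  case (insert j I)
  have "(\<Prod>i\<in>insert j I. 1 - p ^ card (D i))
      = bexp A p (\<lambda>F. 1 - of_bool (D j \<subseteq> F)) * (\<Prod>i\<in>I. 1 - p ^ card (D i))"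
    using insert assms by (simp add: bexp_diff bexp_const bexp_superset)
  also have "\<dots> \<le> bexp A p (\<lambda>F. 1 - of_bool (D j \<subseteq> F)) * bexp A p (\<lambda>F. of_bool (\<forall>i\<in>I. \<not> D i \<subseteq> F))"
    using insert assms
    by (intro mult_left_mono) (auto simp: bexp_diff bexp_const bexp_superset power_le_one)
  also have "\<dots> \<le> bexp A p (\<lambda>F. (1 - of_bool (D j \<subseteq> F)) * of_bool (\<forall>i\<in>I. \<not> D i \<subseteq> F))"
    using assms by (intro bexp_harris) (auto simp: of_bool_def dest: order_trans)
  also have "\<dots> = bexp A p (\<lambda>F. of_bool (\<forall>i\<in>insert j I. \<not> D i \<subseteq> F))"
    by (intro bexp_cong) (auto simp: of_bool_def)
  finally show ?case .
qed

lemma one_minus_ge_exp: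
  fixes t :: real
  assumes "0 \<le> t" "t \<le> 1 / 2"
  shows "exp (- (2 * t)) \<le> 1 - t"
proof -
  have "1 \<le> (1 + 2 * t) * (1 - t)"
    using assms by (auto simp: algebra_simps intro!: mult_left_le)
  also have "\<dots> \<le> exp (2 * t) * (1 - t)"
    using assms by (intro mult_right_mono) auto
  finally show ?thesis by (simp add: exp_minus field_simps)
qed

text \<open>The bound depends only on the expected number of sets \<open>D i\<close> inside the
  random subset, so a bounded expectation leaves a positive chance of avoiding them all.\<close>

lemma bexp_avoid_ge_exp:
  assumes "finite A" "0 \<le> p" "p \<le> 1" "finite I" "\<And>i. i \<in> I \<Longrightarrow> D i \<subseteq> A"
    and small: "\<And>i. i \<in> I \<Longrightarrow> p ^ card (D i) \<le> 1 / 2"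
  shows "exp (- (2 * (\<Sum>i\<in>I. p ^ card (D i)))) \<le> bexp A p (\<lambda>F. of_bool (\<forall>i\<in>I. \<not> D i \<subseteq> F))"
proof -
  have "exp (- (2 * (\<Sum>i\<in>I. p ^ card (D i)))) = (\<Prod>i\<in>I. exp (- (2 * p ^ card (D i))))"
    using assms by (simp add: exp_sum sum_distrib_left flip: sum_negf)
  also have "\<dots> \<le> (\<Prod>i\<in>I. 1 - p ^ card (D i))"
    using assms by (intro prod_mono) (auto intro!: one_minus_ge_exp)
  also have "\<dots> \<le> bexp A p (\<lambda>F. of_bool (\<forall>i\<in>I. \<not> D i \<subseteq> F))"
    by (rule bexp_avoid_ge_prod) (use assms in auto)
  finally show ?thesis .
qed

text \<open>For every t the quantity 2 t X - t^2 X^2 is at most 1 and vanishes where X does, so its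
  expectation bounds the probability of \<open>Q\<close> from below.\<close>

lemma bexp_second_moment:
  assumes "finite A" "0 \<le> p" "p \<le> 1" "0 \<le> a" "0 < b"
    and "\<And>F. F \<subseteq> A \<Longrightarrow> \<not> Q F \<Longrightarrow> X F = 0"
    and "a \<le> bexp A p X" "bexp A p (\<lambda>F. (X F)\<^sup>2) \<le> b"
  shows "a\<^sup>2 / b \<le> bexp A p (\<lambda>F. of_bool (Q F))"
proof -
  \<comment> \<open>This value maximises 2 t a - t^2 b.\<close>
  define t where "t = a / b"
  have t: "0 \<le> t" using assms by (simp add: t_def)
  have "a\<^sup>2 / b = 2 * t * a - t\<^sup>2 * b"
    using assms by (simp add: t_def field_simps power2_eq_square)
  also have "\<dots> \<le> 2 * t * bexp A p X - t\<^sup>2 * bexp A p (\<lambda>F. (X F)\<^sup>2)"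
    using assms t by (intro diff_mono mult_left_mono) auto
  also have "\<dots> = bexp A p (\<lambda>F. 2 * t * X F - t\<^sup>2 * (X F)\<^sup>2)"
    by (simp add: bexp_diff bexp_cmult)
  also have "\<dots> \<le> bexp A p (\<lambda>F. of_bool (Q F))"
  proof (rule bexp_mono)
    fix F assume "F \<subseteq> A"
    have "0 \<le> (1 - t * X F)\<^sup>2" by simp
    then have "2 * t * X F - t\<^sup>2 * (X F)\<^sup>2 \<le> 1"
      by (simp add: power2_eq_square algebra_simps)
    then show "2 * t * X F - t\<^sup>2 * (X F)\<^sup>2 \<le> of_bool (Q F)"
      using assms(6)[OF \<open>F \<subseteq> A\<close>] by (cases "Q F") auto
  qed (use assms in auto)
  finally show ?thesis .
qed

section \<open>Transfer to the random hypergraph\<close>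

lemma finite_possible_edges [simp]: "finite (possible_edges s n)"
  by (rule finite_subset[of _ "Pow {1..n}"]) (auto simp: possible_edges_def)

lemma prob_random_hypergraph:
  assumes p: "0 \<le> p" "p \<le> 1"
  shows "measure_pmf.prob (random_hypergraph s n p) {E. Q E}
    = bexp (possible_edges s n) p (\<lambda>E. of_bool (Q E))"
proof -
  define A where "A = possible_edges s n"
  have fin: "finite A" by (simp add: A_def)
  let ?P = "Pi_pmf A False (\<lambda>_. bernoulli_pmf p)"
  let ?S = "(\<lambda>F e. e \<in> F) ` {F \<in> Pow A. Q F}"
  have "measure_pmf.prob (random_hypergraph s n p) {E. Q E}
      = measure_pmf.prob ?P {g. Q {e \<in> A. g e}}"
    by (simp add: random_hypergraph_def A_def vimage_def)
  also have "\<dots> = measure_pmf.prob ?P ?S"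
  \<comment> \<open>The two sets of functions differ, but they agree on the support of the product,
    where functions are \<open>False\<close> outside \<open>A\<close> and so correspond to subsets
    of \<open>A\<close>.\<close>
  proof (rule measure_pmf.finite_measure_eq_AE)
    have "(g \<in> {g. Q {e \<in> A. g e}}) = (g \<in> ?S)" if "g \<in> set_pmf ?P" for g
    proof -
      have g: "g = (\<lambda>e. e \<in> {e \<in> A. g e})"
        using set_Pi_pmf_subset[OF fin, of False "\<lambda>_. bernoulli_pmf p"] that by (auto simp: fun_eq_iff)
      show ?thesis
      proof
        assume "g \<in> {g. Q {e \<in> A. g e}}"
        then show "g \<in> ?S" by (subst g) (rule imageI, auto)
      next
        assume "g \<in> ?S"
        then obtain F where F: "F \<subseteq> A" "Q F" "g = (\<lambda>e. e \<in> F)" by auto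
        then have "{e \<in> A. g e} = F" by auto
        then show "g \<in> {g. Q {e \<in> A. g e}}" using F by simp
      qed
    qed
    then show "AE g in ?P. (g \<in> {g. Q {e \<in> A. g e}}) = (g \<in> ?S)"
      by (simp add: AE_measure_pmf_iff)
  qed auto
  also have "\<dots> = sum (pmf ?P) ?S"
    using fin by (intro measure_measure_pmf_finite) auto
  also have "\<dots> = (\<Sum>F\<in>{F \<in> Pow A. Q F}. pmf ?P (\<lambda>e. e \<in> F))"
    by (subst sum.reindex) (auto simp: inj_on_def fun_eq_iff)
  also have "\<dots> = (\<Sum>F\<in>{F \<in> Pow A. Q F}. p ^ card F * (1 - p) ^ card (A - F))"
  proof (rule sum.cong[OF refl])
    fix F assume "F \<in> {F \<in> Pow A. Q F}"
    then have F: "F \<subseteq> A" by auto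
    then have "pmf ?P (\<lambda>e. e \<in> F) = (\<Prod>e\<in>A. pmf (bernoulli_pmf p) (e \<in> F))"
      using fin by (intro pmf_Pi') auto
    also have "\<dots> = (\<Prod>e\<in>A. if e \<in> F then p else 1 - p)"
      using p by (intro prod.cong) auto
    also have "\<dots> = p ^ card F * (1 - p) ^ card (A - F)"
      using F fin by (simp add: prod.If_cases Int_absorb1 Diff_eq)
    finally show "pmf ?P (\<lambda>e. e \<in> F) = p ^ card F * (1 - p) ^ card (A - F)" .
  qed
  also have "\<dots> = bexp A p (\<lambda>E. of_bool (Q E))"
    unfolding bexp_def using fin by (intro sum.mono_neutral_cong_left) auto
  finally show ?thesis by (simp add: A_def)
qed

section \<open>Dense subsets and copies in random hypergraphs\<close>

text \<open>\<open>\<eta>\<close> is an excess over density \<open>\<rho>\<close>. At edge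
  probability n^(-1/\<rho>), sets with excess 0 are absent with probability bounded below, and sets
  with positive excess are absent asymptotically almost surely.\<close>

definition has_dense_subset :: "'v set \<Rightarrow> 'v set set \<Rightarrow> nat \<Rightarrow> real \<Rightarrow> real \<Rightarrow> bool" where
  "has_dense_subset V E L \<rho> \<eta> \<longleftrightarrow>
     (\<exists>W\<subseteq>V. W \<noteq> {} \<and> card W \<le> L \<and> \<rho> * card W + \<eta> \<le> card {e \<in> E. e \<subseteq> W})"

text \<open>Fixing the edge set \<open>D\<close> together with \<open>W\<close> turns the existence
  of a dense subset into a union of events \<open>D \<subseteq> E\<close>, as the union bound and
  \<open>bexp_avoid_ge_exp\<close> require.\<close>

definition dense_pairs :: "nat \<Rightarrow> nat \<Rightarrow> nat \<Rightarrow> real \<Rightarrow> real \<Rightarrow> (nat set \<times> nat set set) set" where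
  "dense_pairs s n L \<rho> \<eta> = {(W, D). W \<subseteq> {1..n} \<and> W \<noteq> {} \<and> card W \<le> L \<and>
     D \<subseteq> possible_edges s n \<and> D \<subseteq> Pow W \<and> \<rho> * card W + \<eta> \<le> card D}"

lemma dense_pairs_subset:
  "dense_pairs s n L \<rho> \<eta> \<subseteq> (SIGMA W:{W \<in> Pow {1..n}. card W \<le> L}. Pow (Pow W))"
  by (auto simp: dense_pairs_def)

lemma finite_dense_pairs: "finite (dense_pairs s n L \<rho> \<eta>)"
  by (rule finite_subset[OF dense_pairs_subset]) (auto intro!: finite_SigmaI intro: finite_subset[OF _ finite_atLeastAtMost])

lemma has_dense_subset_iff:
  assumes "E \<subseteq> possible_edges s n"
  shows "has_dense_subset {1..n} E L \<rho> \<eta> \<longleftrightarrow> (\<exists>i\<in>dense_pairs s n L \<rho> \<eta>. snd i \<subseteq> E)"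
proof
  assume "has_dense_subset {1..n} E L \<rho> \<eta>"
  then obtain W where "W \<subseteq> {1..n}" "W \<noteq> {}" "card W \<le> L"
    "\<rho> * card W + \<eta> \<le> card {e \<in> E. e \<subseteq> W}"
    by (auto simp: has_dense_subset_def)
  then show "\<exists>i\<in>dense_pairs s n L \<rho> \<eta>. snd i \<subseteq> E"
    using assms by (intro bexI[of _ "(W, {e \<in> E. e \<subseteq> W})"]) (auto simp: dense_pairs_def)
next
  assume "\<exists>i\<in>dense_pairs s n L \<rho> \<eta>. snd i \<subseteq> E"
  then obtain W D where WD: "(W, D) \<in> dense_pairs s n L \<rho> \<eta>" "D \<subseteq> E" by auto
  have "card D \<le> card {e \<in> E. e \<subseteq> W}"
    using WD assms by (intro card_mono) (auto simp: dense_pairs_def intro: finite_subset[OF _ finite_possible_edges])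
  then have "real (card D) \<le> real (card {e \<in> E. e \<subseteq> W})" by simp
  then show "has_dense_subset {1..n} E L \<rho> \<eta>"
    using WD unfolding has_dense_subset_def dense_pairs_def
    by (intro exI[of _ W]) auto
qed

lemma powr_power_le:
  fixes \<rho> x :: real and n j :: nat
  assumes "1 \<le> n" "0 < \<rho>" "\<rho> * x \<le> j"
  shows "(n powr (- (1 / \<rho>))) ^ j \<le> n powr (- x)"
proof -
  have "(n powr (- (1 / \<rho>))) ^ j = n powr (- (j / \<rho>))"
    using assms by (simp add: powr_powr flip: powr_realpow)
  also have "\<dots> \<le> n powr (- x)"
    using assms by (intro powr_mono) (auto simp: field_simps)
  finally show ?thesis .
qed

text \<open>A pair on w vertices contributes at most n^(-w) n^(-\<eta>/\<rho>), and each
  \<open>W\<close> carries at most 2^(2^L) edge sets. Summing n^(-w) over all subsets of the n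
  vertices gives (1 + 1/n)^n, which is at most e.\<close>

lemma sum_dense_pairs_le:
  assumes n: "1 \<le> n" and \<rho>: "0 < \<rho>"
  shows "(\<Sum>i\<in>dense_pairs s n L \<rho> \<eta>. (n powr (- (1 / \<rho>))) ^ card (snd i))
    \<le> 2 ^ 2 ^ L * exp 1 * n powr (- (\<eta> / \<rho>))"
proof -
  define p where "p = n powr (- (1 / \<rho>))"
  let ?Ws = "{W \<in> Pow {1..n}. card W \<le> L}"
  have finW: "finite W" if "W \<in> ?Ws" for W using that by (auto intro: finite_subset)
  have "(\<Sum>i\<in>dense_pairs s n L \<rho> \<eta>. p ^ card (snd i))
      \<le> (\<Sum>i\<in>dense_pairs s n L \<rho> \<eta>. (1 / n) ^ card (fst i) * n powr (- (\<eta> / \<rho>)))"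
  proof (rule sum_mono)
    fix i assume "i \<in> dense_pairs s n L \<rho> \<eta>"
    then have "\<rho> * (card (fst i) + \<eta> / \<rho>) \<le> card (snd i)"
      using \<rho> by (auto simp: dense_pairs_def algebra_simps)
    then have "p ^ card (snd i) \<le> n powr (- (card (fst i) + \<eta> / \<rho>))"
      unfolding p_def using n \<rho> by (intro powr_power_le)
    also have "\<dots> = n powr (- card (fst i)) * n powr (- (\<eta> / \<rho>))"
      by (simp flip: powr_add)
    also have "\<dots> = (1 / n) ^ card (fst i) * n powr (- (\<eta> / \<rho>))"
      using n by (simp add: powr_minus powr_realpow field_simps)
    finally show "p ^ card (snd i) \<le> (1 / n) ^ card (fst i) * n powr (- (\<eta> / \<rho>))" .
  qed
  also have "\<dots> \<le> (\<Sum>i\<in>(SIGMA W:?Ws. Pow (Pow W)). (1 / n) ^ card (fst i) * n powr (- (\<eta> / \<rho>)))"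
    using finW by (intro sum_mono2 dense_pairs_subset) auto
  also have "\<dots> = (\<Sum>W\<in>?Ws. \<Sum>D\<in>Pow (Pow W). (1 / n) ^ card W * n powr (- (\<eta> / \<rho>)))"
    using finW by (subst sum.Sigma) (auto simp: case_prod_beta)
  also have "\<dots> \<le> (\<Sum>W\<in>?Ws. 2 ^ 2 ^ L * ((1 / n) ^ card W * n powr (- (\<eta> / \<rho>))))"
  proof (rule sum_mono)
    fix W assume W: "W \<in> ?Ws"
    have "(2::real) ^ 2 ^ card W \<le> 2 ^ 2 ^ L"
      using W by (intro power_increasing) auto
    then show "(\<Sum>D\<in>Pow (Pow W). (1 / n) ^ card W * n powr (- (\<eta> / \<rho>)))
        \<le> 2 ^ 2 ^ L * ((1 / n) ^ card W * n powr (- (\<eta> / \<rho>)))"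
      using finW[OF W] by (auto simp: card_Pow intro!: mult_right_mono)
  qed
  also have "\<dots> \<le> (\<Sum>W\<in>Pow {1..n}. 2 ^ 2 ^ L * ((1 / n) ^ card W * n powr (- (\<eta> / \<rho>))))"
    by (intro sum_mono2) auto
  also have "\<dots> = 2 ^ 2 ^ L * (\<Sum>W\<in>Pow {1..n}. (1 / n) ^ card W) * n powr (- (\<eta> / \<rho>))"
    by (simp add: sum_distrib_left sum_distrib_right mult_ac)
  also have "(\<Sum>W\<in>Pow {1..n}. (1 / n) ^ card W) = (1 + 1 / real n) ^ n"
    using prod_add[of "{1..n}" "\<lambda>_. 1 / real n" "\<lambda>_. 1"] by (simp add: add.commute)
  also have "2 ^ 2 ^ L * (1 + 1 / real n) ^ n * n powr (- (\<eta> / \<rho>))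
      \<le> 2 ^ 2 ^ L * exp 1 * n powr (- (\<eta> / \<rho>))"
  proof (intro mult_right_mono mult_left_mono)
    have "(1 + 1 / real n) ^ n \<le> exp (1 / real n) ^ n"
      by (intro power_mono) auto
    also have "\<dots> = exp 1" using n by (simp flip: exp_of_nat_mult)
    finally show "(1 + 1 / real n) ^ n \<le> exp 1" .
  qed auto
  finally show ?thesis by (simp add: p_def)
qed

lemma bexp_has_dense_subset_le:
  assumes "1 \<le> n" "0 < \<rho>"
  shows "bexp (possible_edges s n) (n powr (- (1 / \<rho>)))
      (\<lambda>E. of_bool (has_dense_subset {1..n} E L \<rho> \<eta>)) \<le> 2 ^ 2 ^ L * exp 1 * n powr (- (\<eta> / \<rho>))"
proof -
  define p where "p = n powr (- (1 / \<rho>))"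
  have p: "0 \<le> p" "p \<le> 1"
    using assms powr_mono[of "- (1 / \<rho>)" 0 n] by (auto simp: p_def)
  let ?I = "dense_pairs s n L \<rho> \<eta>"
  have "bexp (possible_edges s n) p (\<lambda>E. of_bool (has_dense_subset {1..n} E L \<rho> \<eta>))
      \<le> bexp (possible_edges s n) p (\<lambda>E. \<Sum>i\<in>?I. of_bool (snd i \<subseteq> E))"
  proof (rule bexp_mono)
    fix E assume E: "E \<subseteq> possible_edges s n"
    show "of_bool (has_dense_subset {1..n} E L \<rho> \<eta>) \<le> (\<Sum>i\<in>?I. of_bool (snd i \<subseteq> E) :: real)"
    proof (cases "has_dense_subset {1..n} E L \<rho> \<eta>")
      case True
      then obtain j where j: "j \<in> ?I" "snd j \<subseteq> E"
        using has_dense_subset_iff[OF E] by auto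
      then have "(of_bool (snd j \<subseteq> E) :: real) \<le> (\<Sum>i\<in>?I. of_bool (snd i \<subseteq> E))"
        by (intro member_le_sum finite_dense_pairs) auto
      then show ?thesis using j True by simp
    qed (auto intro: sum_nonneg)
  qed (use p in auto)
  also have "\<dots> = (\<Sum>i\<in>?I. p ^ card (snd i))"
    unfolding bexp_sum by (intro sum.cong bexp_superset) (auto simp: dense_pairs_def)
  also have "\<dots> \<le> 2 ^ 2 ^ L * exp 1 * n powr (- (\<eta> / \<rho>))"
    unfolding p_def by (rule sum_dense_pairs_le) (use assms in auto)
  finally show ?thesis by (simp add: p_def)
qed

text \<open>With excess 0 the expected number of dense pairs is bounded uniformly in n, so Harris'
  inequality yields a positive lower bound.\<close>

lemma bexp_no_dense_subset_ge:
  assumes n: "2 \<le> n" and \<rho>: "0 < \<rho>"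
  shows "exp (- (2 * (2 ^ 2 ^ L * exp 1))) \<le> bexp (possible_edges s n) (n powr (- (1 / \<rho>)))
      (\<lambda>E. of_bool (\<not> has_dense_subset {1..n} E L \<rho> 0))"
proof -
  define p where "p = n powr (- (1 / \<rho>))"
  have p: "0 \<le> p" "p \<le> 1"
    using assms powr_mono[of "- (1 / \<rho>)" 0 n] by (auto simp: p_def)
  let ?I = "dense_pairs s n L \<rho> 0"
  have "(\<Sum>i\<in>?I. p ^ card (snd i)) \<le> 2 ^ 2 ^ L * exp 1"
    using sum_dense_pairs_le[of n \<rho> s L 0] n \<rho> by (simp add: p_def)
  then have "exp (- (2 * (2 ^ 2 ^ L * exp 1))) \<le> exp (- (2 * (\<Sum>i\<in>?I. p ^ card (snd i))))"
    by simp
  also have "\<dots> \<le> bexp (possible_edges s n) p (\<lambda>E. of_bool (\<forall>i\<in>?I. \<not> snd i \<subseteq> E))"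
  proof (rule bexp_avoid_ge_exp)
    fix i assume i: "i \<in> ?I"
    then show "snd i \<subseteq> possible_edges s n" by (auto simp: dense_pairs_def)
    have "fst i \<subseteq> {1..n}" "fst i \<noteq> {}"
      using i by (auto simp: dense_pairs_def)
    moreover from this have "finite (fst i)" by (auto intro: finite_subset)
    \<comment> \<open>Since \<open>W\<close> is nonempty, a dense pair has at least
      \<open>\<rho>\<close> edges and thus probability at most 1/n, hence at most 1/2.\<close>
    ultimately have "1 \<le> card (fst i)" by (simp add: Suc_le_eq card_gt_0_iff)
    then have "\<rho> * 1 \<le> \<rho> * card (fst i)" using \<rho> by (intro mult_left_mono) auto
    also have "\<dots> \<le> card (snd i)" using i by (auto simp: dense_pairs_def)
    finally have "p ^ card (snd i) \<le> n powr (- 1)"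
      unfolding p_def using n \<rho> by (intro powr_power_le) auto
    also have "\<dots> \<le> 1 / 2" using n by (simp add: powr_minus field_simps)
    finally show "p ^ card (snd i) \<le> 1 / 2" .
  qed (use p finite_dense_pairs in auto)
  also have "\<dots> = bexp (possible_edges s n) p (\<lambda>E. of_bool (\<not> has_dense_subset {1..n} E L \<rho> 0))"
    by (intro bexp_cong arg_cong[where f = of_bool]) (simp only: has_dense_subset_iff, blast)
  finally show ?thesis by (simp add: p_def)
qed

section \<open>The second moment method for copies of a balanced hypergraph\<close>

definition embeddings :: "'v set \<Rightarrow> nat \<Rightarrow> ('v \<Rightarrow> nat) set" where
  "embeddings V n = {f \<in> V \<rightarrow>\<^sub>E {1..n}. inj_on f V}"

lemma card_embeddings_ge:
  assumes "finite V" "2 * card V \<le> n"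
  shows "(real n / 2) ^ card V \<le> card (embeddings V n)"
proof -
  have "(real n / 2) ^ card V = (\<Prod>i\<in>{0..<card V}. real n / 2)" by simp
  also have "\<dots> \<le> (\<Prod>i\<in>{0..<card V}. real (n - i))"
    using assms by (intro prod_mono) (auto simp: of_nat_diff)
  also have "\<dots> = card (embeddings V n)"
    unfolding embeddings_def using assms by (subst card_inj_on_subset_funcset) auto
  finally show ?thesis .
qed

text \<open>Dropping injectivity of \<open>g\<close> only enlarges the sum and lets it factor over
  \<open>V\<close>: a vertex has at most \<open>card V\<close> values in the image of
  \<open>f\<close>, each of weight n, and at most n others of weight 1.\<close>

lemma sum_overlap_le:
  assumes "finite V" "f \<in> embeddings V n" "1 \<le> n"
  shows "(\<Sum>g\<in>embeddings V n. real n ^ card {u \<in> V. g u \<in> f ` V}) \<le> (real n * (card V + 1)) ^ card V"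
proof -
  have fin: "finite V" by fact
  have "(\<Sum>g\<in>embeddings V n. real n ^ card {u \<in> V. g u \<in> f ` V})
      = (\<Sum>g\<in>embeddings V n. \<Prod>u\<in>V. if g u \<in> f ` V then real n else 1)"
    using fin by (intro sum.cong) (auto simp: prod.If_cases Int_def)
  also have "\<dots> \<le> (\<Sum>g\<in>V \<rightarrow>\<^sub>E {1..n}. \<Prod>u\<in>V. if g u \<in> f ` V then real n else 1)"
    using fin by (intro sum_mono2 finite_PiE) (auto simp: embeddings_def intro!: prod_nonneg)
  also have "\<dots> = (\<Prod>u\<in>V. \<Sum>a\<in>{1..n}. if a \<in> f ` V then real n else 1)"
    by (subst prod_sum_PiE) (use fin in auto)
  also have "\<dots> \<le> (\<Prod>u\<in>V. real n * (card V + 1))"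
  proof (rule prod_mono, intro conjI)
    have "(\<Sum>a\<in>{1..n}. if a \<in> f ` V then real n else 1)
        \<le> (\<Sum>a\<in>{1..n}. (if a \<in> f ` V then real n else 0) + 1)"
      by (intro sum_mono) auto
    also have "\<dots> = real n * card ({1..n} \<inter> f ` V) + n"
      by (simp add: sum.distrib sum.If_cases Int_def)
    also have "\<dots> \<le> real n * card V + n"
      using card_image_le[OF fin, of f] card_mono[of "f ` V" "{1..n} \<inter> f ` V"] fin
      by (intro add_mono mult_left_mono) auto
    finally show "(\<Sum>a\<in>{1..n}. if a \<in> f ` V then real n else 1) \<le> real n * (card V + 1)"
      by (simp add: algebra_simps)
  qed (auto intro: sum_nonneg)
  finally show ?thesis by simp
qed

text \<open>At density \<open>\<rho>\<close> the expected number of copies of a balanced hypergraph is bounded below,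
  and a pair of copies overlapping in \<open>t\<close> vertices contributes \<open>n ^ (t - 2 * card V)\<close> at most.\<close>

lemma bexp_copy_ge:
  fixes V :: "'v set" and \<rho> :: real
  assumes fin: "finite V" and EV: "\<And>e. e \<in> H \<Longrightarrow> e \<subseteq> V \<and> card e = s"
    and \<rho>: "0 < \<rho>" and eq: "card H = \<rho> * card V"
    and bal: "\<And>U. U \<subseteq> V \<Longrightarrow> card {e \<in> H. e \<subseteq> U} \<le> \<rho> * card U"
    and n: "1 \<le> n" "2 * card V \<le> n"
  shows "(1 / 4) ^ card V / (card V + 1) ^ card V \<le> bexp (possible_edges s n) (n powr (- (1 / \<rho>)))
      (\<lambda>E. of_bool (\<exists>f\<in>embeddings V n. (`) f ` H \<subseteq> E))"
proof -
  define p where "p = n powr (- (1 / \<rho>))"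
  define v where "v = card V"
  let ?A = "possible_edges s n" and ?I = "embeddings V n"
  define X where "X = (\<lambda>E. \<Sum>f\<in>?I. of_bool ((`) f ` H \<subseteq> E) :: real)"
  have p: "0 \<le> p" "p \<le> 1"
    using n \<rho> powr_mono[of "- (1 / \<rho>)" 0 n] by (auto simp: p_def)
  have finH: "finite H"
    by (rule finite_subset[of _ "Pow V"]) (use EV fin in auto)
  have sub: "(`) f ` H \<subseteq> ?A" if "f \<in> ?I" for f
  proof -
    have "f ` e \<in> ?A" if "e \<in> H" for e
    proof -
      have "card (f ` e) = card e"
        using \<open>f \<in> ?I\<close> EV[OF that] by (intro card_image) (auto simp: embeddings_def intro: inj_on_subset)
      then show ?thesis
        using \<open>f \<in> ?I\<close> EV[OF that] by (auto simp: embeddings_def possible_edges_def)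
    qed
    then show ?thesis by auto
  qed
  have card_img: "card ((`) f ` H) = card H" if "f \<in> ?I" for f
  proof (rule card_image)
    have "inj_on ((`) f) (Pow V)"
      using that by (intro inj_on_image_Pow) (auto simp: embeddings_def)
    then show "inj_on ((`) f) H"
      by (rule inj_on_subset) (use EV in auto)
  qed
  \<comment> \<open>As \<open>H\<close> has density exactly \<open>\<rho>\<close>, a given copy has
    probability n^(-v), which balances the number of embeddings, of order n^v.\<close>
  have "p ^ card H = n powr (- v)"
    using n \<rho> eq by (simp add: p_def v_def powr_powr flip: powr_realpow)
  then have pH: "p ^ card H = 1 / n ^ v"
    using n by (simp add: powr_minus powr_realpow field_simps)

  have EX: "(1 / 2) ^ v \<le> bexp ?A p X"
  proof -
    have "(1 / 2) ^ v = (real n / 2) ^ v * p ^ card H"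
      using n by (simp add: pH power_divide)
    also have "\<dots> \<le> card ?I * p ^ card H"
      using card_embeddings_ge[OF fin n(2)] p by (intro mult_right_mono) (auto simp: v_def)
    also have "\<dots> = (\<Sum>f\<in>?I. p ^ card ((`) f ` H))"
      by (simp add: card_img)
    also have "\<dots> = bexp ?A p X"
      unfolding X_def bexp_sum using sub by (intro sum.cong) (auto simp: bexp_superset)
    finally show ?thesis .
  qed

  have pair: "p ^ card ((`) f ` H \<union> (`) g ` H) \<le> real n ^ card {u \<in> V. g u \<in> f ` V} / n ^ (2 * v)"
    if f: "f \<in> ?I" and g: "g \<in> ?I" for f g
  proof -
    let ?U = "{u \<in> V. g u \<in> f ` V}"
    \<comment> \<open>A common edge of the two copies is the image under \<open>g\<close> of an edge
      inside the overlap \<open>?U\<close>, so balance bounds the number of common edges by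
      \<open>\<rho>\<close> times the size of the overlap.\<close>
    have "(`) f ` H \<inter> (`) g ` H \<subseteq> (`) g ` {e \<in> H. e \<subseteq> ?U}"
    proof
      fix e assume "e \<in> (`) f ` H \<inter> (`) g ` H"
      then obtain a b where "a \<in> H" "e = f ` a" "b \<in> H" "e = g ` b" by auto
      moreover from this have "b \<subseteq> ?U" using EV[of a] EV[of b] by blast
      ultimately show "e \<in> (`) g ` {e \<in> H. e \<subseteq> ?U}" by blast
    qed
    then have "card ((`) f ` H \<inter> (`) g ` H) \<le> card ((`) g ` {e \<in> H. e \<subseteq> ?U})"
      by (rule card_mono[rotated]) (use finH in auto)
    also have "\<dots> \<le> card {e \<in> H. e \<subseteq> ?U}"
      by (rule card_image_le) (use finH in auto)
    also have "real (card {e \<in> H. e \<subseteq> ?U}) \<le> \<rho> * card ?U"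
      by (rule bal) auto
    finally have "card ((`) f ` H \<inter> (`) g ` H) \<le> \<rho> * card ?U" by simp
    moreover have "card ((`) f ` H \<union> (`) g ` H) + card ((`) f ` H \<inter> (`) g ` H) = 2 * card H"
      using card_Un_Int[of "(`) f ` H" "(`) g ` H"] finH card_img f g by simp
    then have "real (card ((`) f ` H \<union> (`) g ` H)) + card ((`) f ` H \<inter> (`) g ` H) = 2 * (\<rho> * v)"
      using eq by (simp add: v_def flip: of_nat_add)
    ultimately have "\<rho> * (2 * real v - card ?U) \<le> card ((`) f ` H \<union> (`) g ` H)"
      by (simp add: algebra_simps)
    then have "p ^ card ((`) f ` H \<union> (`) g ` H) \<le> n powr (- (2 * real v - card ?U))"
      unfolding p_def using n \<rho> by (intro powr_power_le)
    also have "\<dots> = n powr (card ?U - real (2 * v))" by simp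
    also have "\<dots> = real n ^ card ?U / n ^ (2 * v)"
      using n powr_realpow[of "real n" "2 * v"] by (simp only: powr_diff) (simp add: powr_realpow)
    finally show ?thesis .
  qed

  have EX2: "bexp ?A p (\<lambda>E. (X E)\<^sup>2) \<le> (card V + 1) ^ v"
  proof -
    have "bexp ?A p (\<lambda>E. (X E)\<^sup>2)
        = bexp ?A p (\<lambda>E. \<Sum>f\<in>?I. \<Sum>g\<in>?I. of_bool ((`) f ` H \<union> (`) g ` H \<subseteq> E))"
      unfolding X_def power2_eq_square sum_product by (intro bexp_cong sum.cong) auto
    also have "\<dots> = (\<Sum>f\<in>?I. \<Sum>g\<in>?I. p ^ card ((`) f ` H \<union> (`) g ` H))"
      unfolding bexp_sum using sub by (intro sum.cong refl bexp_superset) auto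
    also have "\<dots> \<le> (\<Sum>f\<in>?I. \<Sum>g\<in>?I. real n ^ card {u \<in> V. g u \<in> f ` V} / n ^ (2 * v))"
      by (intro sum_mono pair)
    also have "\<dots> \<le> (\<Sum>f\<in>?I. (real n * (card V + 1)) ^ v / n ^ (2 * v))"
      unfolding sum_divide_distrib[symmetric] v_def using fin n
      by (intro sum_mono divide_right_mono sum_overlap_le) auto
    also have "\<dots> = card ?I * ((real n * (card V + 1)) ^ v / n ^ (2 * v))" by simp
    also have "\<dots> \<le> real n ^ v * ((real n * (card V + 1)) ^ v / n ^ (2 * v))"
    proof (rule mult_right_mono)
      have "card ?I \<le> card (V \<rightarrow>\<^sub>E {1..n})"
        using fin by (intro card_mono finite_PiE) (auto simp: embeddings_def)
      then show "card ?I \<le> real n ^ v" using fin by (simp add: card_funcsetE v_def flip: of_nat_power)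
    qed auto
    also have "\<dots> = (card V + 1) ^ v"
      using n by (simp add: power_mult_distrib power_add mult_2)
    finally show ?thesis by simp
  qed

  have "((1 / 2) ^ v)\<^sup>2 / (card V + 1) ^ v \<le> bexp ?A p (\<lambda>E. of_bool (\<exists>f\<in>?I. (`) f ` H \<subseteq> E))"
    using p EX EX2 by (intro bexp_second_moment) (auto simp: X_def)
  also have "((1 / 2) ^ v)\<^sup>2 = (1 / 4 :: real) ^ v"
    by (simp add: power2_eq_square flip: power_mult_distrib)
  finally show ?thesis by (simp add: p_def v_def)
qed

section \<open>Parameters of the design\<close>

lemma binomial_ge_self:
  assumes "0 < j" "j < n"
  shows "n \<le> n choose j"
  using assms
proof (induction n arbitrary: j)
  case (Suc n)
  show ?case
  proof (cases "j = n")
    case False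
    have "n \<le> n choose j" using Suc False by auto
    moreover obtain l where "j = Suc l" using Suc.prems by (cases j) auto
    moreover have "0 < n choose l" using Suc.prems \<open>j = Suc l\<close> by simp
    ultimately show ?thesis unfolding \<open>j = Suc l\<close> binomial_Suc_Suc by linarith
  qed simp
qed simp

locale two_level_design =
  fixes s r :: nat
  assumes three_le_s: "3 \<le> s" and s_le_r: "s \<le> r"
begin

text \<open>Index \<open>r\<close> stands for the vertex y of a block and the smaller indices for
  the x's; \<open>\<K>\<close> lists the possible links of a vertex z.\<close>

definition \<K> :: "nat set set" where
  "\<K> = {S. S \<subseteq> {..r} \<and> card S = s - 1}"

definition \<J> :: "nat set set set" where
  "\<J> = {i. i \<subseteq> \<K> \<and> card i = 2}"

definition roles :: "(nat set set \<times> nat set) set" where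
  "roles = (SIGMA i:\<J>. \<K> - i)"

text \<open>Of the \<open>m\<close> possible links of z, \<open>c\<close> contain the index
  \<open>r\<close> and \<open>d\<close> avoid it; \<open>d\<close> also counts the edges that join y
  to the x's. \<open>M\<close> is the number of blocks.\<close>

definition m :: nat where "m = Suc r choose (s - 1)"
definition c :: nat where "c = r choose (s - 2)"
definition d :: nat where "d = r choose (s - 1)"
definition M :: nat where "M = m choose 2"

definition \<rho> :: real where
  "\<rho> = (real M * d + real M * (real m - 2) * (real m - 1)) / (r + real M + real M * (real m - 2))"

text \<open>The surplus of a vertex z: it brings m - 1 edges where density \<open>\<rho>\<close>
  asks for \<open>\<rho>\<close>.\<close>

definition \<delta> :: real where "\<delta> = real m - 1 - \<rho>"

lemma m_eq: "m = c + d"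
proof -
  have "s - 1 = Suc (s - 2)" using three_le_s by simp
  then show ?thesis by (simp add: m_def c_def d_def)
qed

lemma r_le: "r \<le> c" "r \<le> d" "3 \<le> r"
  using three_le_s s_le_r by (auto simp: c_def d_def intro!: binomial_ge_self)

lemma m_ge: "6 \<le> m" using m_eq r_le by linarith

lemma M_eq: "2 * real M = real m * (real m - 1)"
proof -
  have "even (m * (m - 1))" by (cases m) auto
  then have "2 * M = m * (m - 1)" by (simp add: M_def choose_two)
  then have "real (2 * M) = real (m * (m - 1))" by simp
  then show ?thesis using m_ge by (simp add: of_nat_diff)
qed

lemma M_pos: "0 < M"
  using m_ge by (simp add: M_def zero_less_binomial_iff)

lemma \<rho>_eq: "\<rho> * (r + real M + real M * (real m - 2)) = real M * d + real M * (real m - 2) * (real m - 1)"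
proof -
  have "0 < r + real M + real M * (real m - 2)"
    using m_ge M_pos r_le by (intro add_pos_nonneg) auto
  then show ?thesis by (simp add: \<rho>_def)
qed

lemma \<delta>_eq: "\<delta> * (r + real M * (real m - 1)) = (real m - 1) * r + real M * (real c - 1)"
proof -
  have d: "real d = real m - real c" by (simp add: m_eq)
  show ?thesis using \<rho>_eq unfolding \<delta>_def d by (simp add: algebra_simps)
qed

lemma \<delta>_pos: "0 < \<delta>"
proof -
  have "0 < (real m - 1) * r + real M * (real c - 1)"
    using m_ge M_pos r_le by (intro add_pos_nonneg) auto
  moreover have "0 \<le> r + real M * (real m - 1)" using m_ge by simp
  ultimately show ?thesis unfolding \<delta>_eq[symmetric] by (simp add: zero_less_mult_iff)
qed

text \<open>This gives the numerical bound on 1/\<alpha>, since c / m equals (s - 1) / (k - 1).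
  After multiplying \<open>\<delta>_eq\<close> by 2 m, the identity \<open>M_eq\<close> exposes a
  common factor m (m - 1), and the remaining comparison follows from \<open>r_le\<close>.\<close>

lemma \<delta>_less: "\<delta> < (real c + 2) / m"
proof -
  have pos: "0 < r + real M * (real m - 1)" using m_ge M_pos by (intro add_nonneg_pos) auto
  have "real m * (2 * ((real m - 1) * r + real M * (real c - 1)))
      = 2 * real m * (real m - 1) * r + real m * (real c - 1) * (2 * real M)"
    by (simp add: algebra_simps)
  also have "\<dots> = real m * (real m - 1) * (2 * r + real m * (real c - 1))"
    unfolding M_eq by (simp add: algebra_simps)
  also have "\<dots> < real m * (real m - 1) * ((real c + 2) * (real m - 1))"
  proof (rule mult_strict_left_mono)
    have "real m = real c + real d" by (simp add: m_eq)
    then show "2 * r + real m * (real c - 1) < (real c + 2) * (real m - 1)"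
      using r_le by (simp add: algebra_simps)
  qed (use m_ge in auto)
  also have "\<dots> = 2 * real M * ((real c + 2) * (real m - 1))" using M_eq by simp
  also have "\<dots> \<le> (real c + 2) * (2 * (r + real M * (real m - 1)))"
    by (simp add: algebra_simps)
  finally have "real m * ((real m - 1) * r + real M * (real c - 1)) < (real c + 2) * (r + real M * (real m - 1))"
    by (simp add: algebra_simps)
  then have "(real m * \<delta>) * (r + real M * (real m - 1)) < (real c + 2) * (r + real M * (real m - 1))"
    unfolding \<delta>_eq[symmetric] by (simp add: mult.assoc)
  then have "real m * \<delta> < real c + 2" using pos by simp
  then show ?thesis using m_ge by (simp add: field_simps)
qed

text \<open>Lets a pair of vertices that serves two roles pay \<open>\<delta>\<close> for each of
  them out of c - 1 edges.\<close>

lemma two_\<delta>_le: "2 * \<delta> \<le> real c - 1"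
proof -
  have "6 * (real c - 1) \<le> real m * (real c - 1)"
    using m_ge r_le by (intro mult_right_mono) auto
  moreover have "2 * (real c + 2) \<le> 6 * (real c - 1)" using r_le by simp
  ultimately have "2 * ((real c + 2) / m) \<le> real c - 1" using m_ge by (simp add: field_simps)
  then show ?thesis using \<delta>_less by linarith
qed

text \<open>Holds because \<rho> - d = c - 1 - \<delta>. Consequently a vertex charged with at most
  \<open>d\<close> edges creates no surplus.\<close>

lemma d_le_\<rho>: "real d \<le> \<rho>"
proof -
  have "1 \<le> real c" using r_le by simp
  then show ?thesis using two_\<delta>_le m_eq \<delta>_def by simp
qed

lemma \<rho>_pos: "0 < \<rho>"
  using d_le_\<rho> r_le by linarith

text \<open>The left side is the surplus of \<open>M\<close> full blocks, each with one y and m - 2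
  vertices z. It exactly pays for the \<open>r\<close> vertices x, which bring no edges of their
  own.\<close>

lemma balance: "real M * (d - \<rho> + \<delta> * (real m - 2)) = \<rho> * r"
  using \<rho>_eq by (simp add: \<delta>_def algebra_simps)

lemma block_nonneg: "0 \<le> d - \<rho> + \<delta> * (real m - 2)"
proof -
  have "0 \<le> real M * (d - \<rho> + \<delta> * (real m - 2))"
    unfolding balance using \<rho>_pos by simp
  then show ?thesis using M_pos by (simp add: zero_le_mult_iff)
qed

lemma finite_\<K>: "finite \<K>" and card_\<K>: "card \<K> = m"
  unfolding \<K>_def m_def using n_subsets[of "{..r}" "s - 1"] by simp_all

lemma finite_\<J>: "finite \<J>" and card_\<J>: "card \<J> = M"
  unfolding \<J>_def M_def using n_subsets[OF finite_\<K>, of 2] finite_\<K> by (simp_all add: card_\<K>)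

lemma finite_roles: "finite roles"
  unfolding roles_def using finite_\<J> finite_\<K> by auto

lemma card_\<K>_diff: "i \<in> \<J> \<Longrightarrow> card (\<K> - i) = m - 2"
  using finite_\<K> finite_subset[of i \<K>] by (auto simp: \<J>_def card_\<K> card_Diff_subset)

lemma card_roles: "card roles = M * (m - 2)"
  unfolding roles_def using finite_\<J> finite_\<K> by (simp add: card_\<K>_diff card_\<J>)

lemma card_base_subsets: "finite A \<Longrightarrow> card A = r \<Longrightarrow> card {S. S \<subseteq> A \<and> card S = s - 1} = d"
  using n_subsets[of A "s - 1"] by (simp add: d_def)

lemma card_\<K>_containing_r: "card {S \<in> \<K>. r \<in> S} = c"
proof -
  have "{S \<in> \<K>. r \<notin> S} = {S. S \<subseteq> {..<r} \<and> card S = s - 1}"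
    unfolding \<K>_def lessThan_Suc_atMost[symmetric] lessThan_Suc by (auto simp: subset_insert)
  then have "card {S \<in> \<K>. r \<notin> S} = d" using card_base_subsets[of "{..<r}"] by simp
  moreover have "card \<K> = card {S \<in> \<K>. r \<in> S} + card {S \<in> \<K>. r \<notin> S}"
    using finite_\<K> by (subst card_Un_disjoint[symmetric]) (auto intro: arg_cong[where f = card])
  ultimately show ?thesis using m_eq card_\<K> by simp
qed

end

section \<open>Density of realizations of the design\<close>

lemma inj_on_insert_image:
  assumes "inj_on g A" "z \<notin> g ` A"
  shows "inj_on (\<lambda>S. insert z (g ` S)) (Pow A)"
proof (rule inj_onI)
  fix S T assume ST: "S \<in> Pow A" "T \<in> Pow A" "insert z (g ` S) = insert z (g ` T)"
  then have "z \<notin> g ` S" "z \<notin> g ` T" using assms by auto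
  then have "g ` S = g ` T" using ST(3) by (metis insert_ident)
  then show "S = T" using ST assms by (meson PowD inj_on_image_eq_iff)
qed

lemma card_fibres_le:
  assumes "finite A" "finite \<W>" "pairwise (\<lambda>v w. g v \<inter> g w = {}) \<W>" "\<And>w. w \<in> \<W> \<Longrightarrow> g w \<subseteq> A"
  shows "(\<Sum>w\<in>\<W>. card (g w)) \<le> card A"
proof -
  have "(\<Sum>w\<in>\<W>. card (g w)) = card (\<Union>w\<in>\<W>. g w)"
    using assms by (subst card_UN_disjoint)  (auto simp: pairwise_def intro: finite_subset[OF assms(4) assms(1)])
  also have "\<dots> \<le> card A" using assms by (intro card_mono) auto
  finally show ?thesis .
qed

context two_level_design
begin

text \<open>The vertex \<open>b\<close> plays the role of a further vertex \<open>x r\<close>.\<close>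

definition exact_link :: "'v set set \<Rightarrow> (nat \<Rightarrow> 'v) \<Rightarrow> 'v \<Rightarrow> nat set \<Rightarrow> 'v \<Rightarrow> bool" where
  "exact_link E x b t a \<longleftrightarrow> a \<notin> insert b (x ` {..<r}) \<and>
     (\<forall>S\<in>\<K>. insert a ((x(r := b)) ` S) \<in> E \<longleftrightarrow> S \<noteq> t)"

definition full_link :: "'v set set \<Rightarrow> (nat \<Rightarrow> 'v) \<Rightarrow> 'v \<Rightarrow> bool" where
  "full_link E x b \<longleftrightarrow> b \<notin> x ` {..<r} \<and>
     (\<forall>S. S \<subseteq> {..<r} \<and> card S = s - 1 \<longrightarrow> insert b (x ` S) \<in> E)"

text \<open>The part of the sentence that the density bound uses: the ban on vertices z for t in i
  survives only as injectivity of \<open>y\<close>.\<close>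

definition config :: "'v set set \<Rightarrow> (nat \<Rightarrow> 'v) \<Rightarrow> (nat set set \<Rightarrow> 'v) \<Rightarrow> (nat set set \<Rightarrow> nat set \<Rightarrow> 'v) \<Rightarrow> bool"
where
  "config E x y z \<longleftrightarrow> inj_on x {..<r} \<and> inj_on y \<J> \<and> (\<forall>i\<in>\<J>. full_link E x (y i)) \<and>
     (\<forall>(i, t)\<in>roles. exact_link E x (y i) t (z i t))"

definition verts :: "(nat \<Rightarrow> 'v) \<Rightarrow> (nat set set \<Rightarrow> 'v) \<Rightarrow> (nat set set \<Rightarrow> nat set \<Rightarrow> 'v) \<Rightarrow> 'v set" where
  "verts x y z = x ` {..<r} \<union> y ` \<J> \<union> (\<lambda>(i, t). z i t) ` roles"

lemma finite_verts: "finite (verts x y z)"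
  unfolding verts_def using finite_\<J> finite_roles by auto

lemma card_verts_le: "card (verts x y z) \<le> r + M + M * (m - 2)"
proof -
  have "card (verts x y z) \<le> card (x ` {..<r}) + card (y ` \<J>) + card ((\<lambda>(i, t). z i t) ` roles)"
    unfolding verts_def by (meson add_le_cancel_right card_Un_le le_trans)
  also have "\<dots> \<le> r + M + M * (m - 2)"
    using card_image_le[of "{..<r}" x] card_image_le[OF finite_\<J>, of y] card_image_le[OF finite_roles, of "\<lambda>(i, t). z i t"]
    unfolding card_roles card_\<J> by simp
  finally show ?thesis .
qed

lemma exact_link_unique:
  assumes "exact_link E x b t a" "exact_link E x b t' a" "t \<in> \<K>"
  shows "t = t'"
  using assms unfolding exact_link_def by blast

lemma image_upd_lessThan: "S \<subseteq> {..<r} \<Longrightarrow> (x(r := b)) ` S = x ` S"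
  by (auto simp: image_def)

lemma image_upd_atMost: "(x(r := b)) ` {..r} = insert b (x ` {..<r})"
  unfolding lessThan_Suc_atMost[symmetric] lessThan_Suc image_insert image_upd_lessThan[OF subset_refl] by simp

lemma inj_on_upd: "inj_on x {..<r} \<Longrightarrow> b \<notin> x ` {..<r} \<Longrightarrow> inj_on (x(r := b)) {..r}"
  unfolding lessThan_Suc_atMost[symmetric] lessThan_Suc by (simp add: inj_on_fun_updI image_upd_lessThan)

text \<open>The vertices \<open>z i t\<close> need not be distinct for different \<open>i\<close> and may coincide with some
  \<open>y j\<close>. Edges are counted by their trace \<open>w\<close> outside the \<open>x\<close>'s. Each vertex outside the \<open>x\<close>'s and
  \<open>y\<close>'s is charged with the \<open>m - 1\<close> edges of one of its roles; every other pair \<open>{y i, z i t}\<close>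
  serves at most two roles and carries at least \<open>c - 1 \<ge> 2 * \<delta>\<close> edges.\<close>

lemma config_dense:
  fixes x :: "nat \<Rightarrow> 'v"
  assumes "config E x y z"
  shows "\<rho> * card (verts x y z) \<le> card {e \<in> E. e \<subseteq> verts x y z}"
proof -
  define X Y Z U where "X = x ` {..<r}" and "Y = y ` \<J>" and "Z = (\<lambda>(i, t). z i t) ` roles - Y"
    and "U = verts x y z"
  have injx: "inj_on x {..<r}" and injy: "inj_on y \<J>"
    and full: "\<And>i. i \<in> \<J> \<Longrightarrow> full_link E x (y i)"
    and exact: "\<And>i t. (i, t) \<in> roles \<Longrightarrow> exact_link E x (y i) t (z i t)"
    using assms by (auto simp: config_def)
  have rolesD: "i \<in> \<J>" "t \<in> \<K>" if "(i, t) \<in> roles" for i t using that by (auto simp: roles_def)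
  have yX: "y i \<notin> X" if "i \<in> \<J>" for i using full[OF that] by (auto simp: full_link_def X_def)
  have zX: "z i t \<notin> X" "z i t \<noteq> y i" if "(i, t) \<in> roles" for i t
    using exact[OF that] by (auto simp: exact_link_def X_def)
  have fin: "finite X" "finite Y" "finite Z"
    using finite_\<J> finite_roles by (auto simp: X_def Y_def Z_def)
  have U: "U = X \<union> Y \<union> Z" by (auto simp: U_def verts_def X_def Y_def Z_def)
  have XY: "X \<inter> Y = {}" using yX by (auto simp: Y_def)
  have XZ: "(X \<union> Y) \<inter> Z = {}" using zX by (auto simp: Z_def)
  have zU: "z i t \<in> U" if "(i, t) \<in> roles" for i t using that by (force simp: U_def verts_def)
  have yY: "y i \<in> Y" if "i \<in> \<J>" for i using that by (simp add: Y_def)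
  have cardU: "card U = r + M + card Z"
    unfolding U using fin XY XZ injx injy
    by (simp add: card_Un_disjoint X_def Y_def card_image card_\<J>)

  define fib where "fib = (\<lambda>w. {e \<in> E. e \<subseteq> U \<and> e - X = w})"
  have finfib: "finite (fib w)" for w
    by (rule finite_subset[of _ "Pow U"]) (use fin in \<open>auto simp: fib_def U\<close>)
  have fib_y: "d \<le> card (fib {y i})" if i: "i \<in> \<J>" for i
  proof -
    let ?B = "{S. S \<subseteq> {..<r} \<and> card S = s - 1}"
    have inj: "inj_on (\<lambda>S. insert (y i) (x ` S)) ?B"
      using inj_on_insert_image[OF injx, of "y i"] yX[OF i] by (auto simp: X_def intro: inj_on_subset)
    have "(\<lambda>S. insert (y i) (x ` S)) ` ?B \<subseteq> fib {y i}"
      using full[OF i] yX[OF i] yY[OF i] by (auto simp: fib_def full_link_def X_def U)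
    then have "card ?B \<le> card (fib {y i})" by (intro card_inj_on_le[OF inj] finfib)
    then show ?thesis using card_base_subsets[of "{..<r}"] by simp
  qed
  have edge: "insert (z i t) ((x(r := y i)) ` S) \<in> fib (if r \<in> S then {y i, z i t} else {z i t})"
    if it: "(i, t) \<in> roles" and S: "S \<in> \<K> - {t}" for i t S
  proof -
    have "S \<subseteq> insert r {..<r}" using S by (auto simp: \<K>_def)
    then have "(x(r := y i)) ` S = x ` (S - {r}) \<union> (if r \<in> S then {y i} else {})" by (auto simp: image_def)
    moreover have "x ` (S - {r}) \<subseteq> X" using \<open>S \<subseteq> insert r {..<r}\<close> by (auto simp: X_def)
    moreover have "insert (z i t) ((x(r := y i)) ` S) \<in> E"
      using exact[OF it] S by (auto simp: exact_link_def)
    ultimately show ?thesis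
      using zX[OF it] zU[OF it] yX yY rolesD[OF it] by (auto simp: fib_def U)
  qed
  have inj: "inj_on (\<lambda>S. insert (z i t) ((x(r := y i)) ` S)) \<K>" if it: "(i, t) \<in> roles" for i t
  proof -
    have "inj_on (x(r := y i)) {..r}" using injx yX rolesD[OF it] by (auto simp: X_def intro: inj_on_upd)
    then have "inj_on (\<lambda>S. insert (z i t) ((x(r := y i)) ` S)) (Pow {..r})"
      using zX[OF it] unfolding X_def by (intro inj_on_insert_image) (simp_all only: image_upd_atMost, auto)
    then show ?thesis by (rule inj_on_subset) (auto simp: \<K>_def)
  qed
  have fib_z: "m - 1 \<le> card (fib {z i t}) + card (fib {y i, z i t})" if it: "(i, t) \<in> roles" for i t
  proof -
    have "m - 1 = card (\<K> - {t})" using rolesD[OF it] finite_\<K> card_\<K> by simp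
    also have "\<dots> \<le> card (fib {z i t} \<union> fib {y i, z i t})"
    proof (rule card_inj_on_le)
      show "inj_on (\<lambda>S. insert (z i t) ((x(r := y i)) ` S)) (\<K> - {t})"
        using inj[OF it] by (rule inj_on_subset) auto
      show "(\<lambda>S. insert (z i t) ((x(r := y i)) ` S)) ` (\<K> - {t}) \<subseteq> fib {z i t} \<union> fib {y i, z i t}"
      proof (rule image_subsetI)
        fix S assume "S \<in> \<K> - {t}"
        from edge[OF it this] show "insert (z i t) ((x(r := y i)) ` S) \<in> fib {z i t} \<union> fib {y i, z i t}"
          by (cases "r \<in> S") auto
      qed
    qed (use finfib in auto)
    also have "\<dots> \<le> card (fib {z i t}) + card (fib {y i, z i t})" by (rule card_Un_le)
    finally show ?thesis .
  qed
  have fib_yz: "c - 1 \<le> card (fib {y i, z i t})" if it: "(i, t) \<in> roles" for i t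
  proof -
    have "c - 1 \<le> card ({S \<in> \<K>. r \<in> S} - {t})"
      using diff_card_le_card_Diff[of "{t}" "{S \<in> \<K>. r \<in> S}"] card_\<K>_containing_r by simp
    also have "\<dots> \<le> card (fib {y i, z i t})"
    proof (rule card_inj_on_le)
      show "inj_on (\<lambda>S. insert (z i t) ((x(r := y i)) ` S)) ({S \<in> \<K>. r \<in> S} - {t})"
        using inj[OF it] by (rule inj_on_subset) auto
      show "(\<lambda>S. insert (z i t) ((x(r := y i)) ` S)) ` ({S \<in> \<K>. r \<in> S} - {t}) \<subseteq> fib {y i, z i t}"
      proof (rule image_subsetI)
        fix S assume "S \<in> {S \<in> \<K>. r \<in> S} - {t}"
        with edge[OF it, of S] show "insert (z i t) ((x(r := y i)) ` S) \<in> fib {y i, z i t}" by auto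
      qed
    qed (use finfib in auto)
    finally show ?thesis .
  qed

  define pr where "pr = (\<lambda>(i, t). {y i, z i t})"
  define Q where "Q = pr ` roles"
  \<comment> \<open>Each vertex of \<open>Z\<close> selects one of its roles. The selected pair
    meets \<open>Z\<close> in that vertex alone, so distinct vertices select distinct pairs;
    \<open>R\<close> collects the pairs left over.\<close>
  have "\<forall>u\<in>Z. \<exists>a. a \<in> roles \<and> z (fst a) (snd a) = u" by (force simp: Z_def)
  then obtain pa where pa: "\<And>u. u \<in> Z \<Longrightarrow> pa u \<in> roles" "\<And>u. u \<in> Z \<Longrightarrow> z (fst (pa u)) (snd (pa u)) = u"
    unfolding bchoice_iff by blast
  define pz where "pz = (\<lambda>u. pr (pa u))"
  have pz: "pz u = {y (fst (pa u)), u}" "fst (pa u) \<in> \<J>" if "u \<in> Z" for u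
    using pa[OF that] rolesD[of "fst (pa u)" "snd (pa u)"] by (auto simp: pz_def pr_def case_prod_beta)
  have pzQ: "pz ` Z \<subseteq> Q" using pa by (auto simp: pz_def Q_def)
  have pzY: "pz u \<inter> Z = {u}" "pz u \<inter> Y = {y (fst (pa u))}" if "u \<in> Z" for u
    using pz[OF that] XZ yY that by auto
  have injpz: "inj_on pz Z" by (rule inj_onI) (metis pzY(1) singleton_inject)
  have finQ: "finite Q" using finite_roles by (simp add: Q_def)
  define R where "R = Q - pz ` Z"

  \<comment> \<open>Roles with the same pair are told apart by their y: injectivity recovers i, the
    other element of the pair is z, and z determines t. So a pair serves at most as many roles as it
    has elements in \<open>Y\<close>: at most two, and only one if it is selected.\<close>
  have pr_fibre: "card {a \<in> roles. pr a = w} \<le> card (w \<inter> Y)" if "w \<in> Q" for w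
  proof (rule card_inj_on_le[where f = "y \<circ> fst"])
    show "inj_on (y \<circ> fst) {a \<in> roles. pr a = w}"
    proof (rule inj_onI, clarsimp)
      fix i t i' t' assume *: "(i, t) \<in> roles" "(i', t') \<in> roles" "pr (i', t') = pr (i, t)" "w = pr (i, t)" "y i = y i'"
      then have "i = i'" using injy rolesD by (auto dest: inj_onD)
      moreover from this have "z i t = z i t'" using * by (auto simp: pr_def doubleton_eq_iff)
      ultimately show "i = i' \<and> t = t'" using * exact exact_link_unique rolesD(2) by metis
    qed
    show "(y \<circ> fst) ` {a \<in> roles. pr a = w} \<subseteq> w \<inter> Y" using rolesD by (auto simp: pr_def Y_def)
    show "finite (w \<inter> Y)" using fin by simp
  qed
  have "card roles = (\<Sum>w\<in>Q. card {a \<in> roles. pr a = w})"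
    unfolding Q_def using sum.image_gen[OF finite_roles, of "\<lambda>_. 1::nat" pr] by simp
  also have "\<dots> = (\<Sum>w\<in>R. card {a \<in> roles. pr a = w}) + (\<Sum>w\<in>pz ` Z. card {a \<in> roles. pr a = w})"
    unfolding R_def by (rule sum.subset_diff[OF pzQ finQ])
  also have "\<dots> \<le> (\<Sum>w\<in>R. 2) + (\<Sum>w\<in>pz ` Z. 1)"
  proof (intro add_mono sum_mono)
    fix w assume w: "w \<in> R"
    then obtain i t where "w = {y i, z i t}" by (auto simp: R_def Q_def pr_def)
    then have "card (w \<inter> Y) \<le> card {y i, z i t}" by (intro card_mono) auto
    also have "\<dots> \<le> 2" by (simp add: card_insert_if)
    finally show "card {a \<in> roles. pr a = w} \<le> 2" using pr_fibre[of w] w by (auto simp: R_def)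
  next
    fix w assume "w \<in> pz ` Z"
    then show "card {a \<in> roles. pr a = w} \<le> 1" using pr_fibre[of w] pzQ pzY by fastforce
  qed
  also have "\<dots> = 2 * card R + card Z" by (simp add: card_image[OF injpz])
  finally have roles_le: "M * (m - 2) \<le> 2 * card R + card Z" by (simp add: card_roles)

  \<comment> \<open>Fibres over distinct traces are disjoint, so edges may be counted separately
    over these singletons and pairs.\<close>
  define \<W> where "\<W> = (\<lambda>u. {u}) ` Y \<union> (\<lambda>u. {u}) ` Z \<union> pz ` Z \<union> R"
  have cardQ: "card w = 2" if "w \<in> Q" for w
    using that zX(2)[symmetric] by (auto simp: Q_def pr_def)
  have "(\<Sum>w\<in>\<W>. card (fib w)) \<le> card {e \<in> E. e \<subseteq> U}"
  proof (rule card_fibres_le)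
    show "finite {e \<in> E. e \<subseteq> U}" by (rule finite_subset[of _ "Pow U"]) (use fin in \<open>auto simp: U\<close>)
    show "finite \<W>" using fin finQ by (auto simp: \<W>_def R_def)
  qed (auto simp: fib_def pairwise_def)
  also have "(\<Sum>w\<in>\<W>. card (fib w)) = (\<Sum>w\<in>(\<lambda>u. {u}) ` Y. card (fib w)) + (\<Sum>w\<in>(\<lambda>u. {u}) ` Z. card (fib w))
      + (\<Sum>w\<in>pz ` Z. card (fib w)) + (\<Sum>w\<in>R. card (fib w))"
  proof -
    have "((\<lambda>u. {u}) ` Y \<union> (\<lambda>u. {u}) ` Z \<union> pz ` Z) \<inter> R = {}"
      using cardQ by (fastforce simp: R_def)
    moreover have "((\<lambda>u. {u}) ` Y \<union> (\<lambda>u. {u}) ` Z) \<inter> pz ` Z = {}"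
      using cardQ pzQ by fastforce
    moreover have "(\<lambda>u. {u}) ` Y \<inter> (\<lambda>u. {u}) ` Z = {}" using XZ by auto
    ultimately show ?thesis
      unfolding \<W>_def using fin finQ by (simp add: sum.union_disjoint R_def del: Un_Diff_cancel)
  qed
  also have "\<dots> = (\<Sum>u\<in>Y. card (fib {u})) + (\<Sum>u\<in>Z. card (fib {u}) + card (fib (pz u))) + (\<Sum>w\<in>R. card (fib w))"
    using injpz by (simp add: sum.reindex sum.distrib inj_on_def)
  finally have "(\<Sum>u\<in>Y. d) + (\<Sum>u\<in>Z. m - 1) + (\<Sum>w\<in>R. c - 1) \<le> card {e \<in> E. e \<subseteq> U}"
  proof (rule order_trans[rotated], intro add_mono sum_mono)
    fix u assume "u \<in> Y" then show "d \<le> card (fib {u})" using fib_y by (auto simp: Y_def)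
  next
    fix u assume "u \<in> Z"
    then show "m - 1 \<le> card (fib {u}) + card (fib (pz u))"
      using fib_z[of "fst (pa u)" "snd (pa u)"] pa pz by simp
  next
    fix w assume "w \<in> R" then show "c - 1 \<le> card (fib w)"
      using fib_yz by (auto simp: R_def Q_def pr_def)
  qed
  moreover have "card Y = M" using injy by (simp add: Y_def card_image card_\<J>)
  ultimately have "M * d + card Z * (m - 1) + card R * (c - 1) \<le> card {e \<in> E. e \<subseteq> U}" by simp
  then have "real (M * d + card Z * (m - 1) + card R * (c - 1)) \<le> card {e \<in> E. e \<subseteq> U}"
    by (simp only: of_nat_le_iff)
  then have e_ge: "real M * d + card Z * (real m - 1) + card R * (real c - 1) \<le> card {e \<in> E. e \<subseteq> U}"
    using m_ge r_le by (simp add: of_nat_diff)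
  have "real (M * (m - 2)) \<le> real (2 * card R + card Z)" using roles_le by (simp only: of_nat_le_iff)
  then have "real M * (real m - 2) \<le> 2 * card R + card Z" using m_ge by (simp add: of_nat_diff)
  \<comment> \<open>Each role is worth \<open>\<delta>\<close>: a vertex of \<open>Z\<close> pays
    \<open>\<delta>\<close>, and a pair in \<open>R\<close> pays twice that out of its c - 1
    edges.\<close>
  then have "\<delta> * (real M * (real m - 2)) \<le> \<delta> * (2 * card R + card Z)"
    using \<delta>_pos by (intro mult_left_mono) auto
  moreover have "card R * (2 * \<delta>) \<le> card R * (real c - 1)"
    using two_\<delta>_le by (intro mult_left_mono) auto
  ultimately have "\<delta> * (real M * (real m - 2)) \<le> \<delta> * card Z + card R * (real c - 1)"
    by (simp add: algebra_simps)
  moreover have "real M * d + \<delta> * (real M * (real m - 2)) = \<rho> * (real r + M)"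
    using balance by (simp add: algebra_simps)
  ultimately have "\<rho> * (real r + M) \<le> real M * d + \<delta> * card Z + card R * (real c - 1)" by linarith
  then have "\<rho> * card U \<le> real M * d + card Z * (real m - 1) + card R * (real c - 1)"
    unfolding cardU by (simp add: \<delta>_def algebra_simps)
  with e_ge show ?thesis by (simp add: U_def)
qed

end

section \<open>The balanced minimal realization\<close>

datatype vertex = VX nat | VY "nat set set" | VZ "nat set set" "nat set"

context two_level_design
begin

text \<open>Matches the update \<open>x(r := b)\<close> in \<open>exact_link\<close>, with
  \<open>VX\<close> for x and \<open>VY i\<close> for b.\<close>

definition base :: "nat set set \<Rightarrow> nat \<Rightarrow> vertex" where
  "base i = VX(r := VY i)"

text \<open>Each edge is assigned to its highest vertex, a z if it contains one and otherwise its y,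
  so that edges can be counted vertex by vertex.\<close>

definition top_edges :: "vertex \<Rightarrow> vertex set set" where
  "top_edges u = (case u of
       VX a \<Rightarrow> {}
     | VY i \<Rightarrow> (\<lambda>S. insert (VY i) (VX ` S)) ` {S. S \<subseteq> {..<r} \<and> card S = s - 1}
     | VZ i t \<Rightarrow> (\<lambda>S. insert (VZ i t) (base i ` S)) ` (\<K> - {t}))"

definition VF :: "vertex set" where "VF = verts VX VY VZ"

definition EF :: "vertex set set" where "EF = (\<Union>u\<in>VF. top_edges u)"

lemma VX_in_VF [simp]: "VX a \<in> VF \<longleftrightarrow> a < r"
  and VY_in_VF [simp]: "VY i \<in> VF \<longleftrightarrow> i \<in> \<J>"
  and VZ_in_VF [simp]: "VZ i t \<in> VF \<longleftrightarrow> (i, t) \<in> roles"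
  by (force simp: VF_def verts_def)+

lemma finite_VF: "finite VF" by (simp add: VF_def finite_verts)

lemma base_image: "S \<subseteq> {..r} \<Longrightarrow> base i ` S \<subseteq> insert (VY i) (VX ` {..<r})"
  by (force simp: base_def)

lemma inj_base: "inj (base i)"
  by (auto simp: base_def inj_on_def)

lemma EF_cases:
  assumes "e \<in> EF"
  obtains (Y) i S where "i \<in> \<J>" "S \<subseteq> {..<r}" "card S = s - 1" "e = insert (VY i) (VX ` S)"
    | (Z) i t S where "(i, t) \<in> roles" "S \<in> \<K>" "S \<noteq> t" "e = insert (VZ i t) (base i ` S)"
proof -
  from assms obtain u where u: "u \<in> VF" "e \<in> top_edges u" by (auto simp: EF_def)
  then show thesis
    by (cases u) (auto simp: top_edges_def intro: that)
qed

lemma EF_YI: "i \<in> \<J> \<Longrightarrow> S \<subseteq> {..<r} \<Longrightarrow> card S = s - 1 \<Longrightarrow> insert (VY i) (VX ` S) \<in> EF"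
  unfolding EF_def by (rule UN_I[of "VY i"]) (auto simp: top_edges_def)

lemma EF_ZI: "(i, t) \<in> roles \<Longrightarrow> S \<in> \<K> \<Longrightarrow> S \<noteq> t \<Longrightarrow> insert (VZ i t) (base i ` S) \<in> EF"
  unfolding EF_def by (rule UN_I[of "VZ i t"]) (auto simp: top_edges_def)

lemma EF_edge:
  assumes "e \<in> EF"
  shows "e \<subseteq> VF \<and> card e = s"
  using assms
proof (cases rule: EF_cases)
  case (Y i S)
  have "finite S" using Y finite_subset by blast
  then have "card e = Suc (card S)"
    unfolding Y(4) by (subst card_insert_disjoint) (auto simp: card_image inj_on_def)
  then have "card e = s" using Y(3) three_le_s by simp
  moreover have "e \<subseteq> VF" using Y(1,2) unfolding Y(4) by auto
  ultimately show ?thesis by simp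
next
  case (Z i t S)
  have S: "S \<subseteq> {..r}" "finite S" "card S = s - 1" using Z by (auto simp: \<K>_def intro: finite_subset)
  then have "VZ i t \<notin> base i ` S" using base_image[of S i] by auto
  then have "card e = Suc (card S)"
    unfolding Z(4) using S card_image[OF inj_on_subset[OF inj_base subset_UNIV], of i S]
    by (subst card_insert_disjoint) auto
  moreover have "e \<subseteq> VF" using Z(1) base_image[OF S(1), of i] unfolding Z(4) by (auto simp: roles_def)
  ultimately show ?thesis using S(3) three_le_s by simp
qed

text \<open>This and the next lemma confine an edge through \<open>VY i\<close> to block i, which
  identifies the links over \<open>VY i\<close> in \<open>copy_imp_design\<close>.\<close>

lemma EF_VY_unique: "e \<in> EF \<Longrightarrow> VY i \<in> e \<Longrightarrow> VY j \<in> e \<Longrightarrow> i = j"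
  by (erule EF_cases) (auto simp: base_def split: if_splits)

lemma EF_VZ_VY: "e \<in> EF \<Longrightarrow> VZ i t \<in> e \<Longrightarrow> VY j \<in> e \<Longrightarrow> i = j"
  by (erule EF_cases) (auto simp: base_def split: if_splits)

lemma config_EF: "config EF VX VY VZ"
proof -
  have "exact_link EF VX (VY i) t (VZ i t)" if it: "(i, t) \<in> roles" for i t
    unfolding exact_link_def base_def[symmetric]
  proof (intro conjI ballI iffI)
    fix S assume S: "S \<in> \<K>" and e: "insert (VZ i t) (base i ` S) \<in> EF"
    from e show "S \<noteq> t"
    proof (cases rule: EF_cases)
      case (Y j T)
      then have "VZ i t \<in> insert (VY j) (VX ` T)" by blast
      then show ?thesis by auto
    next
      case (Z j t' T)
      have ST: "S \<subseteq> {..r}" "T \<subseteq> {..r}" using S Z by (auto simp: \<K>_def)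
      have "VZ i t \<in> insert (VZ j t') (base j ` T)" using Z by blast
      then have ij: "j = i" "t' = t" using base_image[OF ST(2), of j] by auto
      have "VZ i t \<notin> base i ` S" "VZ i t \<notin> base i ` T" using base_image[OF ST(1), of i] base_image[OF ST(2), of i] by auto
      then have "base i ` S = base i ` T" using Z(4) ij by (metis insert_ident)
      then have "S = T" using inj_base by (simp add: inj_image_eq_iff)
      then show ?thesis using Z ij by simp
    qed
  next
    fix S assume "S \<in> \<K>" "S \<noteq> t"
    then show "insert (VZ i t) (base i ` S) \<in> EF" using it by (intro EF_ZI)
  qed auto
  then show ?thesis
    unfolding config_def full_link_def by (auto simp: inj_on_def intro: EF_YI)
qed

lemma card_top_edges_VY: "card {e \<in> top_edges (VY i). e \<subseteq> U} \<le> d"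
proof -
  let ?B = "{S. S \<subseteq> {..<r} \<and> card S = s - 1}"
  have fin: "finite ?B" by simp
  have "card {e \<in> top_edges (VY i). e \<subseteq> U} \<le> card ((\<lambda>S. insert (VY i) (VX ` S)) ` ?B)"
    using fin by (intro card_mono) (auto simp: top_edges_def)
  also have "\<dots> \<le> card ?B" using fin by (rule card_image_le)
  finally show ?thesis using card_base_subsets[of "{..<r}"] by simp
qed

lemma card_top_edges_VZ:
  assumes "(i, t) \<in> roles"
  shows "card {e \<in> top_edges (VZ i t). e \<subseteq> U} \<le> m - 1"
proof -
  have "card {e \<in> top_edges (VZ i t). e \<subseteq> U} \<le> card ((\<lambda>S. insert (VZ i t) (base i ` S)) ` (\<K> - {t}))"
    using finite_\<K> by (intro card_mono) (auto simp: top_edges_def)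
  also have "\<dots> \<le> card (\<K> - {t})" using finite_\<K> by (intro card_image_le) auto
  also have "\<dots> = m - 1" using assms finite_\<K> card_\<K> by (auto simp: roles_def)
  finally show ?thesis .
qed

text \<open>With one base vertex missing, only links among the \<open>r\<close> remaining indices
  can survive.\<close>

lemma card_top_edges_VZ_missing:
  assumes "a \<le> r" "base i a \<notin> U"
  shows "card {e \<in> top_edges (VZ i t). e \<subseteq> U} \<le> d"
proof -
  let ?B = "{S. S \<subseteq> {..r} - {a} \<and> card S = s - 1}"
  have fin: "finite ?B" by simp
  have "{e \<in> top_edges (VZ i t). e \<subseteq> U} \<subseteq> (\<lambda>S. insert (VZ i t) (base i ` S)) ` ?B"
    using assms by (auto simp: top_edges_def \<K>_def)
  then have "card {e \<in> top_edges (VZ i t). e \<subseteq> U} \<le> card ((\<lambda>S. insert (VZ i t) (base i ` S)) ` ?B)"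
    using fin by (intro card_mono) auto
  also have "\<dots> \<le> card ?B" using fin by (rule card_image_le)
  finally show ?thesis using card_base_subsets[of "{..r} - {a}"] assms by simp
qed

text \<open>Edges are charged to their top vertices. If some x is missing from \<open>U\<close>, no
  vertex is charged more than \<open>\<rho>\<close>. Otherwise \<open>U\<close> splits into the x's
  and blocks; a block without its y has no surplus, any other at most that of a full block, and
  \<open>balance\<close> finishes.\<close>

lemma EF_balanced:
  assumes U: "U \<subseteq> VF"
  shows "card {e \<in> EF. e \<subseteq> U} \<le> \<rho> * card U"
proof -
  define h where "h = (\<lambda>u. real (card {e \<in> top_edges u. e \<subseteq> U}))"
  have finU: "finite U" using U finite_VF finite_subset by blast
  have fintop: "finite (top_edges u)" for u using finite_\<K> by (cases u) (auto simp: top_edges_def)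
  have top: "u \<in> e" if "e \<in> top_edges u" for u e using that by (cases u) (auto simp: top_edges_def)
  have "{e \<in> EF. e \<subseteq> U} \<subseteq> (\<Union>u\<in>U. {e \<in> top_edges u. e \<subseteq> U})"
    using top by (fastforce simp: EF_def)
  then have "card {e \<in> EF. e \<subseteq> U} \<le> card (\<Union>u\<in>U. {e \<in> top_edges u. e \<subseteq> U})"
    using finU fintop by (intro card_mono) auto
  also have "\<dots> \<le> (\<Sum>u\<in>U. card {e \<in> top_edges u. e \<subseteq> U})"
    using finU by (rule card_UN_le)
  finally have "real (card {e \<in> EF. e \<subseteq> U}) \<le> real (\<Sum>u\<in>U. card {e \<in> top_edges u. e \<subseteq> U})"
    by (simp only: of_nat_le_iff)
  then have le: "real (card {e \<in> EF. e \<subseteq> U}) \<le> sum h U" by (simp add: h_def)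
  have hX: "h (VX a) = 0" for a by (simp add: h_def top_edges_def)
  have hY: "h (VY i) \<le> d" for i using card_top_edges_VY by (simp add: h_def)
  have hZ: "h (VZ i t) \<le> real m - 1" if "(i, t) \<in> roles" for i t
    using card_top_edges_VZ[OF that, of U] m_ge by (simp add: h_def)
  have hZ': "h (VZ i t) \<le> d" if "a \<le> r" "base i a \<notin> U" for i t a
    using card_top_edges_VZ_missing[OF that] by (simp add: h_def)
  show ?thesis
  proof (cases "VX ` {..<r} \<subseteq> U")
    case False
    then obtain a where a: "a < r" "VX a \<notin> U" by auto
    have "h u \<le> \<rho>" for u
    proof (cases u)
      case (VZ i t)
      then show ?thesis using hZ'[of a i t] a d_le_\<rho> by (simp add: base_def)
    qed (use hX order_trans[OF hY d_le_\<rho>] \<rho>_pos in \<open>auto simp: less_imp_le\<close>)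
    then have "sum h U \<le> (\<Sum>u\<in>U. \<rho>)" by (intro sum_mono)
    then show ?thesis using le by (simp add: mult.commute)
  next
    case True
    define Ui where "Ui = (\<lambda>i. {u \<in> U. u = VY i \<or> (\<exists>t. u = VZ i t)})"
    have Ueq: "U = VX ` {..<r} \<union> (\<Union>i\<in>\<J>. Ui i)"
    proof (intro equalityI subsetI)
      fix u assume "u \<in> U"
      then show "u \<in> VX ` {..<r} \<union> (\<Union>i\<in>\<J>. Ui i)"
        using U by (cases u) (auto simp: Ui_def roles_def dest!: subsetD[of U])
    qed (use True in \<open>auto simp: Ui_def\<close>)
    have block: "(\<Sum>u\<in>Ui i. h u - \<rho>) \<le> d - \<rho> + \<delta> * (real m - 2)" if i: "i \<in> \<J>" for i
    proof (cases "VY i \<in> U")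
      case False
      have "(\<Sum>u\<in>Ui i. h u - \<rho>) \<le> 0"
      proof (rule sum_nonpos)
        fix u assume "u \<in> Ui i"
        then obtain t where "u = VZ i t" using False by (auto simp: Ui_def)
        then show "h u - \<rho> \<le> 0" using hZ'[of r i t] False d_le_\<rho> by (simp add: base_def)
      qed
      then show ?thesis using block_nonneg by simp
    next
      case True
      let ?T = "{t. VZ i t \<in> U}"
      have T: "?T \<subseteq> \<K> - i" using U by (auto simp: roles_def)
      then have finT: "finite ?T" using finite_\<K> finite_subset by blast
      have "Ui i = insert (VY i) (VZ i ` ?T)" using True by (auto simp: Ui_def)
      then have "(\<Sum>u\<in>Ui i. h u - \<rho>) = h (VY i) - \<rho> + (\<Sum>t\<in>?T. h (VZ i t) - \<rho>)"
        using finT by (simp add: sum.reindex inj_on_def image_iff)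
      also have "\<dots> \<le> d - \<rho> + (\<Sum>t\<in>?T. \<delta>)"
      proof (intro add_mono sum_mono)
        fix t assume "t \<in> ?T"
        then have "(i, t) \<in> roles" using U by auto
        then show "h (VZ i t) - \<rho> \<le> \<delta>" using hZ by (simp add: \<delta>_def)
      qed (use hY in auto)
      also have "\<dots> = d - \<rho> + \<delta> * card ?T" by simp
      also have "\<dots> \<le> d - \<rho> + \<delta> * (real m - 2)"
      proof -
        have "card ?T \<le> m - 2" using card_mono[OF _ T] finite_\<K> card_\<K>_diff[OF i] by simp
        then have "real (card ?T) \<le> real m - 2" using m_ge by simp
        then show ?thesis using \<delta>_pos by simp
      qed
      finally show ?thesis .
    qed
    have "sum h U - \<rho> * card U = (\<Sum>u\<in>U. h u - \<rho>)" by (simp add: sum_subtractf mult.commute)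
    also have "\<dots> = (\<Sum>u\<in>VX ` {..<r}. h u - \<rho>) + (\<Sum>u\<in>(\<Union>i\<in>\<J>. Ui i). h u - \<rho>)"
      unfolding Ueq using finU finite_\<J> by (intro sum.union_disjoint) (auto simp: Ui_def)
    also have "(\<Sum>u\<in>VX ` {..<r}. h u - \<rho>) = - (\<rho> * r)"
      by (simp add: sum.reindex inj_on_def hX)
    also have "(\<Sum>u\<in>(\<Union>i\<in>\<J>. Ui i). h u - \<rho>) = (\<Sum>i\<in>\<J>. \<Sum>u\<in>Ui i. h u - \<rho>)"
      using finU finite_\<J> by (intro sum.UNION_disjoint) (auto simp: Ui_def)
    also have "\<dots> \<le> (\<Sum>i\<in>\<J>. d - \<rho> + \<delta> * (real m - 2))" by (intro sum_mono block)
    also have "\<dots> = real M * (d - \<rho> + \<delta> * (real m - 2))" by (simp add: card_\<J>)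
    also have "\<dots> = \<rho> * r" by (rule balance)
    finally show ?thesis using le by simp
  qed
qed

lemma EF_subset_VF: "{e \<in> EF. e \<subseteq> VF} = EF"
  using EF_edge by auto

text \<open>The bounds of \<open>config_dense\<close> and \<open>EF_balanced\<close> meet at
  \<open>VF\<close>, which replaces a direct count.\<close>

lemma card_EF: "card EF = \<rho> * card VF"
  using EF_balanced[of VF] config_dense[OF config_EF] unfolding EF_subset_VF VF_def[symmetric] by simp

lemma finite_EF: "finite EF"
  by (rule finite_subset[of _ "Pow VF"]) (use EF_edge finite_VF in auto)

end

section \<open>The sentence\<close>

text \<open>The trivially true \<open>Eq 0 0\<close> makes variable 0 free; the outer quantifiers of
  \<open>design_fo\<close> bind it, as \<open>r\<close> is positive.\<close>

primrec big_conj :: "fo list \<Rightarrow> fo" where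
  "big_conj [] = Eq 0 0"
| "big_conj (\<phi> # \<phi>s) = Conj \<phi> (big_conj \<phi>s)"

definition conj_over :: "'a set \<Rightarrow> ('a \<Rightarrow> fo) \<Rightarrow> fo" where
  "conj_over A f = big_conj (map f (SOME l. set l = A))"

lemma set_some_list: "finite A \<Longrightarrow> set (SOME l. set l = A) = A"
  by (rule someI_ex) (rule finite_list)

lemma fo_sat_big_conj: "fo_sat V E v (big_conj \<phi>s) \<longleftrightarrow> (\<forall>\<phi>\<in>set \<phi>s. fo_sat V E v \<phi>)"
  and fo_wf_big_conj: "fo_wf s (big_conj \<phi>s) \<longleftrightarrow> (\<forall>\<phi>\<in>set \<phi>s. fo_wf s \<phi>)"
  and free_vars_big_conj: "free_vars (big_conj \<phi>s) = insert 0 (\<Union>\<phi>\<in>set \<phi>s. free_vars \<phi>)"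
  and depth_big_conj: "quantifier_depth (big_conj \<phi>s) \<le> l \<longleftrightarrow> (\<forall>\<phi>\<in>set \<phi>s. quantifier_depth \<phi> \<le> l)"
  by (induction \<phi>s) auto

lemma fo_sat_conj_over: "finite A \<Longrightarrow> fo_sat V E v (conj_over A f) \<longleftrightarrow> (\<forall>a\<in>A. fo_sat V E v (f a))"
  and fo_wf_conj_over: "finite A \<Longrightarrow> fo_wf s (conj_over A f) \<longleftrightarrow> (\<forall>a\<in>A. fo_wf s (f a))"
  and free_vars_conj_over: "finite A \<Longrightarrow> free_vars (conj_over A f) = insert 0 (\<Union>a\<in>A. free_vars (f a))"
  and depth_conj_over: "finite A \<Longrightarrow>
    quantifier_depth (conj_over A f) \<le> l \<longleftrightarrow> (\<forall>a\<in>A. quantifier_depth (f a) \<le> l)"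
  by (simp_all add: conj_over_def fo_sat_big_conj fo_wf_big_conj free_vars_big_conj depth_big_conj set_some_list)

lemmas conj_over_simps = fo_sat_conj_over fo_wf_conj_over free_vars_conj_over depth_conj_over

primrec exs :: "nat \<Rightarrow> fo \<Rightarrow> fo" where
  "exs 0 \<phi> = \<phi>"
| "exs (Suc t) \<phi> = exs t (Ex t \<phi>)"

lemma fo_wf_exs: "fo_wf s (exs t \<phi>) \<longleftrightarrow> fo_wf s \<phi>"
  and free_vars_exs: "free_vars (exs t \<phi>) = free_vars \<phi> - {..<t}"
  and depth_exs: "quantifier_depth (exs t \<phi>) = t + quantifier_depth \<phi>"
  by (induction t arbitrary: \<phi>) (auto simp: less_Suc_eq)

lemma fo_sat_exs:
  "fo_sat V E v (exs t \<phi>) \<longleftrightarrow> (\<exists>w. w ` {..<t} \<subseteq> V \<and> (\<forall>a\<ge>t. w a = v a) \<and> fo_sat V E w \<phi>)"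
proof (induction t arbitrary: \<phi>)
  case 0
  have "w = v" if "\<forall>a. w a = v a" for w using that by auto
  then show ?case by auto
next
  case (Suc t)
  show ?case
  proof
    assume "fo_sat V E v (exs (Suc t) \<phi>)"
    then obtain w a where "w ` {..<t} \<subseteq> V" "\<forall>a\<ge>t. w a = v a" "a \<in> V" "fo_sat V E (w(t := a)) \<phi>"
      unfolding exs.simps Suc.IH by auto
    then show "\<exists>w. w ` {..<Suc t} \<subseteq> V \<and> (\<forall>a\<ge>Suc t. w a = v a) \<and> fo_sat V E w \<phi>"
      by (intro exI[of _ "w(t := a)"]) (auto simp: lessThan_Suc)
  next
    assume "\<exists>w. w ` {..<Suc t} \<subseteq> V \<and> (\<forall>a\<ge>Suc t. w a = v a) \<and> fo_sat V E w \<phi>"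
    then obtain w where "w ` {..<Suc t} \<subseteq> V" "\<forall>a\<ge>Suc t. w a = v a" "fo_sat V E w \<phi>" by auto
    then show "fo_sat V E v (exs (Suc t) \<phi>)"
      unfolding exs.simps Suc.IH
      by (intro exI[of _ "w(t := v t)"]) (auto simp: lessThan_Suc intro!: bexI[of _ "w t"])
  qed
qed

definition fresh :: "nat \<Rightarrow> fo" where
  "fresh t = conj_over {..<t} (\<lambda>a. Neg (Eq t a))"

text \<open>Sorting merely fixes some order: \<open>N\<close> is evaluated on the set of values of
  its arguments.\<close>

definition edge :: "nat \<Rightarrow> nat set \<Rightarrow> fo" where
  "edge a S = N (a # sorted_list_of_set S)"

context two_level_design
begin

definition \<B> :: "nat set set" where
  "\<B> = {S. S \<subseteq> {..<r} \<and> card S = s - 1}"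

definition exact_fo :: "nat set \<Rightarrow> fo" where
  "exact_fo t = Conj (fresh (Suc r))
     (conj_over \<K> (\<lambda>S. if S = t then Neg (edge (Suc r) S) else edge (Suc r) S))"

definition full_fo :: fo where
  "full_fo = Conj (fresh r) (conj_over \<B> (edge r))"

text \<open>All blocks reuse the variables \<open>r\<close> and \<open>Suc r\<close> for their y and
  z, so together they cost only two nested quantifiers.\<close>

definition block_fo :: "nat set set \<Rightarrow> fo" where
  "block_fo i = Ex r (Conj full_fo (conj_over \<K> (\<lambda>t.
     if t \<in> i then Neg (Ex (Suc r) (exact_fo t)) else Ex (Suc r) (exact_fo t))))"

definition design_fo :: fo where
  "design_fo = exs r (Conj (conj_over {..<r} fresh) (conj_over \<J> block_fo))"

definition design :: "'v set \<Rightarrow> 'v set set \<Rightarrow> (nat \<Rightarrow> 'v) \<Rightarrow> bool" where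
  "design V E x \<longleftrightarrow> inj_on x {..<r} \<and> x ` {..<r} \<subseteq> V \<and>
     (\<forall>i\<in>\<J>. \<exists>b\<in>V. full_link E x b \<and> (\<forall>t\<in>\<K>. t \<notin> i \<longleftrightarrow> (\<exists>a\<in>V. exact_link E x b t a)))"

lemma finite_\<B>: "finite \<B>"
  by (simp add: \<B>_def)

lemmas design_simps = conj_over_simps[OF finite_\<K>] conj_over_simps[OF finite_\<J>]
  conj_over_simps[OF finite_\<B>] conj_over_simps[OF finite_lessThan]

lemma \<B>D: "S \<in> \<B> \<Longrightarrow> S \<subseteq> {..<r} \<and> finite S \<and> card S = s - 1"
  by (auto simp: \<B>_def intro: finite_subset)

lemma \<K>D: "S \<in> \<K> \<Longrightarrow> S \<subseteq> {..r} \<and> finite S \<and> card S = s - 1"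
  by (auto simp: \<K>_def intro: finite_subset)

lemma design_fo_sentence: "sentence s design_fo"
proof -
  have K: "S \<in> \<K> \<Longrightarrow> x \<in> S \<Longrightarrow> x \<le> r" for S x using \<K>D by auto
  have "Suc (s - 1) = s" using three_le_s by simp
  then have "fo_wf s design_fo"
    using \<K>D \<B>D
    by (auto simp: design_fo_def fo_wf_exs design_simps block_fo_def full_fo_def exact_fo_def fresh_def edge_def)
  moreover have "free_vars (exact_fo t) \<subseteq> {..Suc r}" if "t \<in> \<K>" for t
    using K \<K>D by (auto simp: design_simps exact_fo_def fresh_def edge_def split: if_splits) (metis le_Suc_eq)+
  then have block: "free_vars (block_fo i) \<subseteq> {..<r}" if "i \<in> \<J>" for i
    using r_le \<B>D
    by (fastforce simp: block_fo_def full_fo_def design_simps fresh_def edge_def split: if_splits)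
  have fresh: "free_vars (fresh t) \<subseteq> {..<r}" if "t < r" for t
    using that by (auto simp: fresh_def design_simps)
  have "free_vars (Conj (conj_over {..<r} fresh) (conj_over \<J> block_fo)) \<subseteq> {..<r}"
    unfolding free_vars.simps design_simps using r_le by (intro Un_least insert_subsetI UN_least block fresh) auto
  then have "free_vars design_fo = {}" by (auto simp: design_fo_def free_vars_exs)
  ultimately show ?thesis by (simp add: sentence_def)
qed

lemma design_fo_depth: "quantifier_depth design_fo \<le> r + 2"
proof -
  have fresh: "quantifier_depth (fresh t) \<le> l" for t l by (simp add: fresh_def design_simps)
  have "quantifier_depth (exact_fo t) \<le> 0" for t
    unfolding exact_fo_def quantifier_depth.simps max.bounded_iff by (simp only: design_simps fresh) (simp add: edge_def)
  moreover have "quantifier_depth full_fo \<le> 1"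
    unfolding full_fo_def quantifier_depth.simps max.bounded_iff by (simp only: design_simps fresh) (simp add: edge_def)
  ultimately have "quantifier_depth (block_fo i) \<le> 2" for i
    unfolding block_fo_def quantifier_depth.simps
    by (simp add: design_simps numeral_2_eq_2)
  then show ?thesis by (simp add: design_fo_def depth_exs design_simps fresh)
qed

lemma fo_sat_design_fo:
  "fo_sat V E v design_fo \<longleftrightarrow> (\<exists>x. (\<forall>a\<ge>r. x a = v a) \<and> design V E x)"
proof -
  have fresh: "fo_sat V E w (fresh t) \<longleftrightarrow> w t \<notin> w ` {..<t}" for w t
    by (auto simp: fresh_def design_simps)
  have inj: "(\<forall>t\<in>{..<l}. w t \<notin> w ` {..<t}) \<longleftrightarrow> inj_on w {..<l}" for w :: "nat \<Rightarrow> 'a" and l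
    by (induction l) (auto simp: lessThan_Suc)
  have full: "fo_sat V E (x(r := b)) full_fo \<longleftrightarrow> full_link E x b" for x b
  proof -
    have "fo_sat V E (x(r := b)) (edge r S) \<longleftrightarrow> insert b (x ` S) \<in> E" if "S \<in> \<B>" for S
    proof -
      have "(x(r := b)) ` set (r # sorted_list_of_set S) = insert b (x ` S)"
        using \<B>D[OF that] by (simp only: list.set set_sorted_list_of_set image_insert fun_upd_same image_upd_lessThan)
      then show ?thesis by (simp only: edge_def fo_sat.simps)
    qed
    moreover have "(\<forall>S. S \<subseteq> {..<r} \<and> card S = s - 1 \<longrightarrow> insert b (x ` S) \<in> E) \<longleftrightarrow> (\<forall>S\<in>\<B>. insert b (x ` S) \<in> E)"
      by (simp add: \<B>_def)
    ultimately show ?thesis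
      unfolding full_fo_def full_link_def fo_sat.simps fresh design_simps image_upd_lessThan[OF subset_refl] by simp
  qed
  have exact: "fo_sat V E (x(r := b, Suc r := a)) (exact_fo t) \<longleftrightarrow> exact_link E x b t a" for x b a t
  proof -
    have img: "(x(r := b, Suc r := a)) ` S = (x(r := b)) ` S" if "S \<subseteq> {..r}" for S
      using that by (intro image_cong) auto
    have "fo_sat V E (x(r := b, Suc r := a)) (edge (Suc r) S) \<longleftrightarrow> insert a ((x(r := b)) ` S) \<in> E"
      if "S \<in> \<K>" for S
    proof -
      have "(x(r := b, Suc r := a)) ` set (Suc r # sorted_list_of_set S) = insert a ((x(r := b)) ` S)"
        using \<K>D[OF that] by (simp only: list.set set_sorted_list_of_set image_insert fun_upd_same img)
      then show ?thesis by (simp only: edge_def fo_sat.simps)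
    qed
    then have "fo_sat V E (x(r := b, Suc r := a)) (if S = t then Neg (edge (Suc r) S) else edge (Suc r) S)
        \<longleftrightarrow> (insert a ((x(r := b)) ` S) \<in> E \<longleftrightarrow> S \<noteq> t)" if "S \<in> \<K>" for S
      using that by auto
    then show ?thesis
      unfolding exact_fo_def exact_link_def fo_sat.simps fresh design_simps lessThan_Suc_atMost image_upd_atMost[symmetric]
        img[OF subset_refl] fun_upd_same by blast
  qed
  have block: "fo_sat V E x (block_fo i) \<longleftrightarrow>
      (\<exists>b\<in>V. full_link E x b \<and> (\<forall>t\<in>\<K>. t \<notin> i \<longleftrightarrow> (\<exists>a\<in>V. exact_link E x b t a)))" for x i
    unfolding block_fo_def fo_sat.simps full design_simps if_distrib[of "fo_sat V E _"] exact by auto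
  show ?thesis
    unfolding design_fo_def fo_sat_exs fo_sat.simps design_simps block fresh design_def inj
    by (rule ex_cong1) (simp only: conj_ac)
qed

lemma models_design_fo: "models V E design_fo \<longleftrightarrow> (\<exists>x. design V E x)"
  unfolding models_sentence_iff[OF design_fo_sentence, of V E undefined] fo_sat_design_fo
proof
  assume "\<exists>x. design V E x"
  then obtain x where "design V E x" by auto
  \<comment> \<open>At the valuation x itself the side condition of \<open>fo_sat_design_fo\<close>
    is trivial; for a sentence the truth value then carries over to every valuation.\<close>
  then have "fo_sat V E x design_fo" unfolding fo_sat_design_fo by auto
  then have "models V E design_fo" using models_sentence_iff[OF design_fo_sentence] by blast
  then show "\<exists>x. (\<forall>a\<ge>r. x a = undefined a) \<and> design V E x"
    unfolding models_def fo_sat_design_fo by blast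
qed auto

section \<open>Between the sentence and vertex sets of large density\<close>

lemma design_imp_dense:
  assumes "design V E x"
  shows "has_dense_subset V E (r + M + M * (m - 2)) \<rho> 0"
proof -
  define P where "P i b \<longleftrightarrow> b \<in> V \<and> full_link E x b \<and>
      (\<forall>t\<in>\<K>. t \<notin> i \<longleftrightarrow> (\<exists>a\<in>V. exact_link E x b t a))" for i b
  have "\<forall>i\<in>\<J>. \<exists>b. P i b" using assms unfolding design_def P_def by blast
  then obtain y where "\<forall>i\<in>\<J>. P i (y i)" unfolding bchoice_iff by blast
  then have y: "\<And>i. i \<in> \<J> \<Longrightarrow> y i \<in> V" "\<And>i. i \<in> \<J> \<Longrightarrow> full_link E x (y i)"
    "\<And>i t. i \<in> \<J> \<Longrightarrow> t \<in> \<K> \<Longrightarrow> t \<notin> i \<longleftrightarrow> (\<exists>a\<in>V. exact_link E x (y i) t a)"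
    unfolding P_def by blast+
  define z where "z = (\<lambda>i t. SOME a. a \<in> V \<and> exact_link E x (y i) t a)"
  have z: "z i t \<in> V \<and> exact_link E x (y i) t (z i t)" if "(i, t) \<in> roles" for i t
    unfolding z_def by (rule someI_ex) (use that y(3) in \<open>auto simp: roles_def\<close>)
  \<comment> \<open>The set i is recovered from \<open>y i\<close> as the set of those t in
    \<open>\<K>\<close> that have no exact link over \<open>y i\<close>.\<close>
  have "inj_on y \<J>"
  proof (rule inj_onI)
    fix i j assume ij: "i \<in> \<J>" "j \<in> \<J>" "y i = y j"
    then have "t \<in> i \<longleftrightarrow> t \<in> j" if "t \<in> \<K>" for t using y(3)[OF _ that] by metis
    then show "i = j" using ij by (auto simp: \<J>_def)
  qed
  then have "config E x y z"
    using assms y(2) z by (auto simp: config_def design_def)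
  then have "\<rho> * card (verts x y z) \<le> card {e \<in> E. e \<subseteq> verts x y z}" by (rule config_dense)
  moreover have "verts x y z \<subseteq> V"
    using assms y(1) z by (auto simp: verts_def design_def)
  moreover have "x 0 \<in> verts x y z" using r_le by (auto simp: verts_def)
  ultimately show ?thesis
    unfolding has_dense_subset_def using card_verts_le[of x y z] by (intro exI[of _ "verts x y z"]) auto
qed

text \<open>Any edge or link beyond those of the copy of \<open>EF\<close> creates a subset of density greater
  than \<open>\<rho>\<close>, because \<open>\<rho> < m - 1\<close>.\<close>

lemma copy_imp_design:
  fixes V :: "'v set"
  assumes f: "inj_on f VF" "f ` VF \<subseteq> V" "(`) f ` EF \<subseteq> E" and "finite E"
    and sparse: "\<not> has_dense_subset V E (card VF + 1) \<rho> (min 1 \<delta>)"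
  shows "design V E (f \<circ> VX)"
proof -
  let ?x = "f \<circ> VX"
  have inj_EF: "inj_on ((`) f) (Pow VF)" using f(1) by (rule inj_on_image_Pow)
  have card_img: "card ((`) f ` EF) = card EF"
    using EF_edge by (intro card_image inj_on_subset[OF inj_EF]) auto
  have img_sub: "f ` e \<subseteq> f ` VF" if "e \<in> EF" for e
    using EF_edge[OF that] by (intro image_mono) auto
  have fV: "f u \<in> V" if "u \<in> VF" for u using f(2) that by auto
  have VF_ne: "VF \<noteq> {}" using VX_in_VF[of 0] r_le by force
  \<comment> \<open>The copy is induced, since one extra edge inside it would give excess 1.\<close>
  have edges: "f ` A \<in> E \<longleftrightarrow> A \<in> EF" if A: "A \<subseteq> VF" for A
  proof
    assume fA: "f ` A \<in> E"
    show "A \<in> EF"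
    proof (rule ccontr)
      assume "A \<notin> EF"
      then have "f ` A \<notin> (`) f ` EF"
        using inj_onD[OF inj_EF, of A] A EF_edge by blast
      then have "card (insert (f ` A) ((`) f ` EF)) = card EF + 1"
        using finite_EF card_img by simp
      moreover have "insert (f ` A) ((`) f ` EF) \<subseteq> {e \<in> E. e \<subseteq> f ` VF}"
        using fA f(3) img_sub A by blast
      then have "card (insert (f ` A) ((`) f ` EF)) \<le> card {e \<in> E. e \<subseteq> f ` VF}"
        using \<open>finite E\<close> by (intro card_mono) auto
      ultimately have "real (card EF) + 1 \<le> card {e \<in> E. e \<subseteq> f ` VF}" by linarith
      moreover have "card (f ` VF) = card VF" using f(1) by (rule card_image)
      ultimately have "has_dense_subset V E (card VF + 1) \<rho> (min 1 \<delta>)"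
        unfolding has_dense_subset_def using f(2) VF_ne card_EF by (intro exI[of _ "f ` VF"]) auto
      then show False using sparse by contradiction
    qed
  qed (use f(3) in auto)
  have f_eq: "f u = f w \<longleftrightarrow> u = w" if "u \<in> VF" "w \<in> VF" for u w
    using f(1) that by (auto dest: inj_onD)
  have upd: "?x(r := f (VY i)) = f \<circ> base i" for i by (auto simp: base_def)
  have link: "insert (f u) ((?x(r := f (VY i))) ` S) = f ` insert u (base i ` S)" for u i S
    unfolding upd by (simp add: image_comp)
  have base_VF: "base i ` S \<subseteq> VF" if "i \<in> \<J>" "S \<subseteq> {..r}" for i S
    using base_image[OF that(2), of i] that(1) by auto
  have exact: "exact_link E ?x (f (VY i)) t (f u) \<longleftrightarrow> exact_link EF VX (VY i) t u"
    if "i \<in> \<J>" "u \<in> VF" for i u t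
  proof -
    have "insert (f u) ((?x(r := f (VY i))) ` S) \<in> E \<longleftrightarrow> insert u (base i ` S) \<in> EF" if "S \<in> \<K>" for S
      unfolding link using base_VF[of i S] \<open>i \<in> \<J>\<close> \<K>D[OF that] \<open>u \<in> VF\<close> by (intro edges) auto
    moreover have "f u \<notin> insert (f (VY i)) (?x ` {..<r}) \<longleftrightarrow> u \<notin> insert (VY i) (VX ` {..<r})"
      using that f_eq by (auto simp: image_iff)
    ultimately show ?thesis by (auto simp: exact_link_def base_def)
  qed
  have links: "(\<exists>a\<in>V. exact_link E ?x (f (VY i)) t a) \<longleftrightarrow> t \<notin> i" if i: "i \<in> \<J>" and t: "t \<in> \<K>" for i t
  proof
    assume "t \<notin> i"
    then have it: "(i, t) \<in> roles" using i t by (auto simp: roles_def)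
    then have "exact_link EF VX (VY i) t (VZ i t)" using config_EF by (auto simp: config_def)
    then have "exact_link E ?x (f (VY i)) t (f (VZ i t))" using exact[OF i] it by simp
    then show "\<exists>a\<in>V. exact_link E ?x (f (VY i)) t a" by (rule bexI) (simp add: fV it)
  next
    assume "\<exists>a\<in>V. exact_link E ?x (f (VY i)) t a"
    then obtain a where a: "a \<in> V" "exact_link E ?x (f (VY i)) t a" by auto
    show "t \<notin> i"
    proof (cases "a \<in> f ` VF")
      case False
      \<comment> \<open>A vertex \<open>a\<close> outside the copy would add m - 1 new edges, hence
        excess m - 1 - \<rho> = \<delta>.\<close>
      let ?g = "\<lambda>S. insert a ((f \<circ> base i) ` S)"
      let ?W = "insert a (f ` VF)"
      have "inj_on (f \<circ> base i) {..r}"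
        by (intro comp_inj_on inj_on_subset[OF inj_base] inj_on_subset[OF f(1)] base_VF i) auto
      moreover have "a \<notin> (f \<circ> base i) ` {..r}"
        using base_VF[OF i subset_refl] False unfolding image_comp[symmetric] by blast
      ultimately have "inj_on ?g (Pow {..r})" by (rule inj_on_insert_image)
      then have "inj_on ?g (\<K> - {t})" by (rule inj_on_subset) (auto simp: \<K>_def)
      then have "card (?g ` (\<K> - {t})) = m - 1"
        using t finite_\<K> card_\<K> by (simp add: card_image)
      moreover have "?g ` (\<K> - {t}) \<inter> (`) f ` EF = {}" using False EF_edge by blast
      ultimately have "card (?g ` (\<K> - {t}) \<union> (`) f ` EF) = (m - 1) + card EF"
        using finite_\<K> finite_EF card_img by (subst card_Un_disjoint) auto
      moreover have "card (?g ` (\<K> - {t}) \<union> (`) f ` EF) \<le> card {e \<in> E. e \<subseteq> ?W}"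
      proof (rule card_mono)
        have g: "?g S \<in> E \<and> ?g S \<subseteq> ?W" if "S \<in> \<K> - {t}" for S
          using a(2) that base_VF[OF i, of S] \<K>D[of S] unfolding exact_link_def upd image_comp[symmetric] by blast
        have f_EF: "f ` e \<in> E \<and> f ` e \<subseteq> ?W" if "e \<in> EF" for e
          using f(3) img_sub[OF that] that by auto
        show "?g ` (\<K> - {t}) \<union> (`) f ` EF \<subseteq> {e \<in> E. e \<subseteq> ?W}"
        proof (intro Un_least image_subsetI CollectI)
          fix S assume "S \<in> \<K> - {t}"
          then show "?g S \<in> E \<and> ?g S \<subseteq> ?W" by (rule g)
        next
          fix e assume "e \<in> EF"
          then show "f ` e \<in> E \<and> f ` e \<subseteq> ?W" by (rule f_EF)
        qed
      qed (use \<open>finite E\<close> in auto)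
      ultimately have "(real m - 1) + card EF \<le> card {e \<in> E. e \<subseteq> ?W}" using m_ge by linarith
      moreover have "card ?W = card VF + 1"
        using False finite_VF card_image[OF f(1)] by simp
      ultimately have "\<rho> * card ?W + min 1 \<delta> \<le> card {e \<in> E. e \<subseteq> ?W}"
        using card_EF by (simp add: \<delta>_def algebra_simps)
      then have "has_dense_subset V E (card VF + 1) \<rho> (min 1 \<delta>)"
        unfolding has_dense_subset_def using f(2) a(1) \<open>card ?W = card VF + 1\<close>
        by (intro exI[of _ ?W]) auto
      then show ?thesis using sparse by contradiction
    next
      case True
      then obtain u where u: "u \<in> VF" "a = f u" by auto
      then have ex: "exact_link EF VX (VY i) t u" using exact[OF i] a by simp
      \<comment> \<open>As \<open>c\<close> is at least 2, some link other than \<open>t\<close>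
        contains the index \<open>r\<close>. Its edge contains both \<open>u\<close> and
        \<open>VY i\<close>, which forces \<open>u\<close> to be a z of block i.\<close>
      have "\<not> {S \<in> \<K>. r \<in> S} \<subseteq> {t}"
        using card_mono[of "{t}" "{S \<in> \<K>. r \<in> S}"] card_\<K>_containing_r r_le by auto
      then obtain S where S: "S \<in> \<K>" "r \<in> S" "S \<noteq> t" by auto
      define e where "e = insert u (base i ` S)"
      have e: "e \<in> EF" "u \<in> e" "VY i \<in> e"
        using ex S by (auto simp: exact_link_def base_def e_def)
      show ?thesis
      proof (cases u)
        case (VX b)
        then show ?thesis using ex u by (auto simp: exact_link_def)
      next
        case (VY j)
        then show ?thesis using ex EF_VY_unique[OF e(1), of i j] e by (auto simp: exact_link_def)
      next
        case (VZ j t')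
        then have "j = i" using EF_VZ_VY[OF e(1)] e by auto
        then have it': "(i, t') \<in> roles" using u VZ by simp
        then have "exact_link EF VX (VY i) t' u" using config_EF VZ \<open>j = i\<close> by (auto simp: config_def)
        then have "t = t'" by (rule exact_link_unique[OF ex _ t])
        then show ?thesis using it' by (auto simp: roles_def)
      qed
    qed
  qed
  have full: "full_link E ?x (f (VY i))" if i: "i \<in> \<J>" for i
  proof -
    have "f (VY i) \<notin> ?x ` {..<r}" using f_eq i by (auto simp: image_iff)
    moreover have "insert (f (VY i)) (?x ` S) \<in> E" if "S \<subseteq> {..<r}" "card S = s - 1" for S
    proof -
      have "f ` insert (VY i) (VX ` S) \<in> E" using f(3) EF_YI[OF i that] by blast
      then show ?thesis by (simp add: image_comp)
    qed
    ultimately show ?thesis by (auto simp: full_link_def)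
  qed
  show ?thesis
    unfolding design_def
  proof (intro conjI ballI)
    show "inj_on ?x {..<r}" using f_eq by (auto simp: inj_on_def)
    show "?x ` {..<r} \<subseteq> V" using fV by auto
    fix i assume "i \<in> \<J>"
    then show "\<exists>b\<in>V. full_link E ?x b \<and> (\<forall>t\<in>\<K>. t \<notin> i \<longleftrightarrow> (\<exists>a\<in>V. exact_link E ?x b t a))"
      using full links fV by (intro bexI[of _ "f (VY i)"]) auto
  qed
qed

end

section \<open>Failure of the zero-one law\<close>

context two_level_design
begin

text \<open>The probability of \<open>design_fo\<close> stays away from 1 because the dense subset
  it implies can be avoided, and away from 0 because copies of \<open>EF\<close> occur.\<close>

lemma design_not_zero_one: "\<not> obeys_zero_one_law s (r + 2) (\<lambda>n. real n powr (- (1 / \<rho>)))"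
proof
  assume law: "obeys_zero_one_law s (r + 2) (\<lambda>n. real n powr (- (1 / \<rho>)))"
  define p where "p n = real n powr (- (1 / \<rho>))" for n :: nat
  define P where "P n = bexp (possible_edges s n) (p n) (\<lambda>E. of_bool (\<exists>x. design {1..n} E x))" for n
  have p: "0 \<le> p n" "p n \<le> 1" for n
    using \<rho>_pos powr_mono[of "- (1 / \<rho>)" 0 n] by (cases "n = 0"; auto simp: p_def)+
  have P: "measure_pmf.prob (random_hypergraph s n (p n)) {E. models {1..n} E design_fo} = P n" for n
    by (simp only: prob_random_hypergraph[OF p] models_design_fo P_def)
  have "P \<longlonglongrightarrow> 0 \<or> P \<longlonglongrightarrow> 1"
    using law[unfolded obeys_zero_one_law_def Let_def, rule_format, of design_fo]
      design_fo_sentence design_fo_depth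
    unfolding p_def[symmetric] P by blast
  moreover have "\<not> P \<longlonglongrightarrow> 1"
  proof
    define L where "L = r + M + M * (m - 2)"
    define q :: real where "q = exp (- (2 * (2 ^ 2 ^ L * exp 1)))"
    assume "P \<longlonglongrightarrow> 1"
    moreover have "P n \<le> 1 - q" if "2 \<le> n" for n
    proof -
      have "P n \<le> bexp (possible_edges s n) (p n) (\<lambda>E. 1 - of_bool (\<not> has_dense_subset {1..n} E L \<rho> 0))"
        unfolding P_def L_def using design_imp_dense p by (intro bexp_mono) (auto simp: of_bool_def)
      also have "\<dots> \<le> 1 - q"
        using bexp_no_dense_subset_ge[OF that \<rho>_pos, of L s]
        by (simp add: bexp_diff bexp_const p_def q_def)
      finally show ?thesis .
    qed
    ultimately have "1 \<le> 1 - q" by (intro LIMSEQ_le_const2) auto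
    then show False by (simp add: q_def)
  qed
  moreover have "\<not> P \<longlonglongrightarrow> 0"
  proof
    define \<eta> where "\<eta> = min 1 \<delta>"
    define L where "L = card VF + 1"
    define q :: real where "q = (1 / 4) ^ card VF / (card VF + 1) ^ card VF"
    define b where "b n = 2 ^ 2 ^ L * exp 1 * real n powr (- (\<eta> / \<rho>))" for n :: nat
    assume "P \<longlonglongrightarrow> 0"
    \<comment> \<open>A copy of \<open>EF\<close> satisfies the sentence unless a set of excess
      \<open>\<eta>\<close> exists; \<open>b n\<close> bounds the probability of the latter and
      tends to 0 as \<open>\<eta>\<close> is positive.\<close>
    moreover have "q - b n \<le> P n" if n: "max 1 (2 * card VF) \<le> n" for n
    proof -
      let ?A = "possible_edges s n"
      have "q \<le> bexp ?A (p n) (\<lambda>E. of_bool (\<exists>f\<in>embeddings VF n. (`) f ` EF \<subseteq> E))"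
        unfolding q_def p_def using n
        by (intro bexp_copy_ge finite_VF EF_edge \<rho>_pos card_EF EF_balanced) auto
      moreover have "bexp ?A (p n) (\<lambda>E. of_bool (has_dense_subset {1..n} E L \<rho> \<eta>)) \<le> b n"
        unfolding b_def p_def using n by (intro bexp_has_dense_subset_le \<rho>_pos) auto
      moreover have "bexp ?A (p n) (\<lambda>E. of_bool (\<exists>f\<in>embeddings VF n. (`) f ` EF \<subseteq> E)
          - of_bool (has_dense_subset {1..n} E L \<rho> \<eta>)) \<le> P n"
        unfolding P_def
      proof (intro bexp_mono p)
        fix E assume E: "E \<subseteq> ?A"
        have "design {1..n} E (f \<circ> VX)"
          if "f \<in> embeddings VF n" "(`) f ` EF \<subseteq> E" "\<not> has_dense_subset {1..n} E L \<rho> \<eta>" for f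
          using that finite_subset[OF E] by (intro copy_imp_design) (auto simp: embeddings_def L_def \<eta>_def)
        then show "of_bool (\<exists>f\<in>embeddings VF n. (`) f ` EF \<subseteq> E)
            - of_bool (has_dense_subset {1..n} E L \<rho> \<eta>) \<le> (of_bool (\<exists>x. design {1..n} E x) :: real)"
          by (auto simp: of_bool_def)
      qed
      ultimately show ?thesis by (simp add: bexp_diff)
    qed
    moreover have "(\<lambda>n. q - b n) \<longlonglongrightarrow> q - 2 ^ 2 ^ L * exp 1 * 0"
      unfolding b_def using \<delta>_pos \<rho>_pos
      by (intro tendsto_intros tendsto_neg_powr filterlim_real_sequentially) (auto simp: \<eta>_def)
    ultimately have "q - 2 ^ 2 ^ L * exp 1 * 0 \<le> 0"
      by (intro LIMSEQ_le[OF _ _ exI[of _ "max 1 (2 * card VF)"]]) auto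
    moreover have "0 < q" unfolding q_def by (intro divide_pos_pos) auto
    ultimately show False by simp
  qed
  ultimately show False by blast
qed

end

theorem theorem7:
  fixes s k :: nat
  assumes "s \<ge> 3" and "k \<ge> s + 2"
  shows "\<exists>\<alpha>::real. \<alpha> > 0 \<and>
           1 / \<alpha> > real ((k - 1) choose (s - 1)) - 1 - (real s - 1) / (real k - 1)
                    - 2 / real ((k - 1) choose (s - 1)) \<and>
           \<not> obeys_zero_one_law s k (\<lambda>n. real n powr (- \<alpha>))"
proof -
  define r where "r = k - 2"
  have k: "k = r + 2" using assms by (simp add: r_def)
  interpret two_level_design s r using assms by unfold_locales (auto simp: r_def)
  have m: "(k - 1) choose (s - 1) = m" by (simp add: m_def k)
  have "Suc (s - 2) = s - 1" using assms by simp
  \<comment> \<open>Absorption identifies c / m with the fraction (s - 1) / (k - 1) of the claim, so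
    that \<open>\<delta>_less\<close> applies.\<close>
  then have "(s - 1) * m = Suc r * c"
    using binomial_absorption[of "s - 2" "Suc r"] by (simp add: m_def c_def)
  then have "real ((s - 1) * m) = real (Suc r * c)" by simp
  then have "(real s - 1) * m = (real k - 1) * c" using assms by (simp add: k of_nat_diff ring_distribs)
  moreover have "0 < real k - 1" "0 < real m" using m_ge by (auto simp: k)
  ultimately have "(real s - 1) / (real k - 1) = c / m" by (simp add: field_simps)
  then have "real m - 1 - (real s - 1) / (real k - 1) - 2 / m < \<rho>"
    using \<delta>_less by (simp add: \<delta>_def add_divide_distrib)
  then show ?thesis
    using \<rho>_pos design_not_zero_one unfolding m k[symmetric] by (intro exI[of _ "1 / \<rho>"]) auto
qed

end
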